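(* There are positive universal constants $c_1$, $c_2$ and $c_3$ such that for all primes $p$ and all $k\ge 1$, $$c_1e^{-c_2\frac{k}{p^2}}\le \|Q^{*k}-U\|_{TV}\le c_3e^{-\frac{c_2k}{p^2}}.$$
   Context: For a prime $p$, $\mathcal{A}_p$ is the affine group mod $p$: its elements are the pairs $(a,b)$ with $1\le a\le p-1$, $0\le b\le p-1$, with product $(a_1,b_1)(a_2,b_2)=(a_1a_2,\,a_1b_2+b_1)$, all entries taken mod $p$. Fix a generator $g$ of the multiplicative group mod $p$, and let $S=\{(1,0),(1,1),(1,-1),(g,0),(g^{-1},0)\}$. Define $Q$ on $\mathcal{A}_p$ by $Q(h)=\frac15$ if $h\in S$ and $Q(h)=0$ otherwise. $Q^{*k}$ denotes the $k$-fold convolution power of $Q$, that is, $Q^{*1}=Q$ and $Q^{*k}(h)=\sum_{h'\in\mathcal{A}_p}Q(h')\,Q^{*(k-1)}(h(h')^{-1})$. $U$ is the uniform distribution $U(h)=\frac{1}{p(p-1)}$ on $\mathcal{A}_p$, and $\|\cdot\|_{TV}$ is the total variation distance, $\|\mu-\nu\|_{TV}=\frac12\sum_{h}|\mu(h)-\nu(h)|$.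
   Formalization: The two bounds may have different exponent constants (one common c_2 is impossible: p=5 forces c_2≥12.77, large p forces c_2≤7.9); for p=2,3, where elements of S coincide and Q as printed has mass below 1, the five steps are counted with multiplicity. *)

theory Defs
  imports "HOL-Analysis.Analysis" "HOL-Number_Theory.Number_Theory"
    "HOL-Library.Multiset" "HOL-Algebra.Group"
begin

text \<open>Pairs are in reduced form, i.e. both entries are the canonical representatives mod \<open>p\<close>.\<close>

definition affine_group :: "nat \<Rightarrow> (int \<times> int) monoid" where
  "affine_group p =
     \<lparr>carrier = {1..int p - 1} \<times> {0..int p - 1},
      mult = (\<lambda>(a1, b1) (a2, b2). ((a1 * a2) mod int p, (a1 * b2 + b1) mod int p)),
      one = (1, 0)\<rparr>"

text \<open>
  For \<open>p \<ge> 5\<close> the five steps are pairwise distinct, and this is just the set of steps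
  (see \<open>walk_measure_eq\<close> below). For \<open>p = 2\<close> and \<open>p = 3\<close> some of them coincide; counting
  them with multiplicity is what keeps the walk a probability measure for these primes.
\<close>

definition walk_steps :: "nat \<Rightarrow> nat \<Rightarrow> (int \<times> int) multiset" where
  "walk_steps p g =
     {#(1, 0), (1, 1), (1, (- 1) mod int p), (int g, 0), (modular_inverse (int p) (int g), 0)#}"

definition walk_measure :: "nat \<Rightarrow> nat \<Rightarrow> int \<times> int \<Rightarrow> real" where
  "walk_measure p g h = real (count (walk_steps p g) h) / 5"

text \<open>
  The value at exponent \<open>0\<close> is the point mass at the identity; exponent \<open>1\<close> is listed
  separately because that is where the usual definition starts.
\<close>

fun conv_power :: "('a, 'b) monoid_scheme \<Rightarrow> ('a \<Rightarrow> real) \<Rightarrow> nat \<Rightarrow> 'a \<Rightarrow> real" where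
  "conv_power G Q 0 h = (if h = \<one>\<^bsub>G\<^esub> then 1 else 0)"
| "conv_power G Q (Suc 0) h = Q h"
| "conv_power G Q (Suc (Suc k)) h =
     (\<Sum>h'\<in>carrier G. Q h' * conv_power G Q (Suc k) (h \<otimes>\<^bsub>G\<^esub> inv\<^bsub>G\<^esub> h'))"

definition uniform_affine :: "nat \<Rightarrow> int \<times> int \<Rightarrow> real" where
  "uniform_affine p h = 1 / (real p * (real p - 1))"

definition tv_dist :: "('a, 'b) monoid_scheme \<Rightarrow> ('a \<Rightarrow> real) \<Rightarrow> ('a \<Rightarrow> real) \<Rightarrow> real" where
  "tv_dist G \<mu> \<nu> = (1 / 2) * (\<Sum>h\<in>carrier G. \<bar>\<mu> h - \<nu> h\<bar>)"

text \<open>Sanity checks: the structure is a group, and the walk is the intended probability measure.\<close>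

lemma affine_group_is_group:
  assumes p: "prime p"
  shows "group (affine_group p)"
proof (rule groupI, goal_cases)
  case (1 x y)
  obtain a b c d where x: "x = (a, b)" and y: "y = (c, d)" by (cases x, cases y)
  have p2: "int p > 1" using p prime_gt_1_nat by simp
  have "\<not> int p dvd a" "\<not> int p dvd c"
    using 1 x y by (auto simp: affine_group_def dest: zdvd_imp_le)
  then have "\<not> int p dvd a * c" using p by (simp add: prime_dvd_mult_iff)
  then have "(a * c) mod int p \<noteq> 0" by (simp add: dvd_eq_mod_eq_0)
  moreover have "0 \<le> (a * c) mod int p" "(a * c) mod int p < int p" using p2 by auto
  ultimately have "1 \<le> (a * c) mod int p" "(a * c) mod int p \<le> int p - 1" by linarith+
  moreover have "0 \<le> (a * d + b) mod int p" "(a * d + b) mod int p \<le> int p - 1"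
    using p2 pos_mod_bound[of "int p" "a * d + b"] by auto
  ultimately show ?case unfolding x y affine_group_def by simp
next
  case 2
  then show ?case using prime_gt_1_nat[OF p] by (auto simp: affine_group_def)
next
  case (3 x y z)
  obtain a b c d e f where xyz: "x = (a, b)" "y = (c, d)" "z = (e, f)"
    by (cases x, cases y, cases z)
  have "[((a * c) mod int p) * f + (a * d + b) mod int p = a * c * f + (a * d + b)] (mod int p)"
    by (intro cong_add cong_mult) (simp_all add: cong_def)
  moreover have "[a * ((c * f + d) mod int p) + b = a * (c * f + d) + b] (mod int p)"
    by (intro cong_add cong_mult) (simp_all add: cong_def)
  ultimately have "[((a * c) mod int p) * f + (a * d + b) mod int p
      = a * ((c * f + d) mod int p) + b] (mod int p)"
    by (simp add: cong_def algebra_simps)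
  then show ?case
    by (simp add: xyz affine_group_def cong_def mod_simps mult.assoc)
next
  case (4 x)
  then show ?case by (cases x) (auto simp: affine_group_def)
next
  case (5 x)
  obtain a b where x: "x = (a, b)" by (cases x)
  have p2: "int p > 1" using p prime_gt_1_nat by simp
  define c where "c = modular_inverse (int p) a"
  have "\<not> int p dvd a" using 5 x by (auto simp: affine_group_def dest: zdvd_imp_le)
  then have cop: "coprime a (int p)"
    using p prime_imp_coprime[of "int p" a] by (simp add: coprime_commute)
  then have "[c * a = 1] (mod int p)" unfolding c_def by (rule cong_modular_inverse2)
  then have ca: "(c * a) mod int p = 1" using p2 by (simp add: cong_def)
  have "c > 0" unfolding c_def by (rule mult_modular_inverse_int_pos[OF p2 cop])
  moreover have "c < int p" unfolding c_def using modular_inverse_int_less p2 by simp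
  ultimately have "(c, (- (c * b)) mod int p) \<in> carrier (affine_group p)"
    using p2 pos_mod_bound[of "int p" "- (c * b)"] by (simp add: affine_group_def)
  moreover have "(c, (- (c * b)) mod int p) \<otimes>\<^bsub>affine_group p\<^esub> x = \<one>\<^bsub>affine_group p\<^esub>"
    using ca by (simp add: x affine_group_def mod_simps)
  ultimately show ?case by blast
qed

lemma walk_measure_eq:
  assumes p: "prime p" "p \<ge> 5" and g: "residue_primroot p g" "g < p"
  shows "walk_measure p g h =
    (if h \<in> {(1, 0), (1, 1), (1, (- 1) mod int p), (int g, 0),
             (modular_inverse (int p) (int g), 0)} then 1 / 5 else 0)"
proof -
  let ?c = "modular_inverse (int p) (int g)"
  have cop: "coprime (int g) (int p)"
    using g by (simp add: residue_primroot_def coprime_commute)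
  have tot: "ord p g = p - 1" using g p by (simp add: residue_primroot_def totient_prime)
  have m1: "(- 1) mod int p = int p - 1" using p by (simp add: zmod_zminus1_eq_if)
  have g1: "g \<noteq> 1" using tot p by auto
  have cg: "[int g * ?c = 1] (mod int p)" by (rule cong_modular_inverse1[OF cop])
  have c1: "?c \<noteq> 1"
  proof
    assume "?c = 1"
    then have "[int g = int 1] (mod int p)" using cg by simp
    then have "[g = 1] (mod p)" using cong_int_iff by blast
    then show False using g1 g p by (simp add: cong_def)
  qed
  have gc: "int g \<noteq> ?c"
  proof
    assume "int g = ?c"
    then have "[int (g ^ 2) = int 1] (mod int p)" using cg by (simp add: power2_eq_square)
    then have "[g ^ 2 = 1] (mod p)" using cong_int_iff by blast
    then have "ord p g dvd 2" using ord_divides by blast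
    then have "p - 1 \<le> 2" using tot by (auto dest: dvd_imp_le)
    then show False using p by simp
  qed
  show ?thesis
    using g1 c1 gc p by (simp add: walk_measure_def walk_steps_def m1)
qed

lemma walk_measure_sum:
  assumes p: "prime p" and g: "residue_primroot p g" "g < p"
  shows "(\<Sum>h\<in>carrier (affine_group p). walk_measure p g h) = 1"
proof -
  have p2: "int p > 1" using p prime_gt_1_nat by simp
  have cop: "coprime (int g) (int p)"
    using g by (simp add: residue_primroot_def coprime_commute)
  have "g > 0" using cop p2 by (cases g) auto
  then have sub: "set_mset (walk_steps p g) \<subseteq> carrier (affine_group p)"
    using g p2 mult_modular_inverse_int_pos[OF p2 cop]
      modular_inverse_int_less[of "int p" "int g"] pos_mod_bound[of "int p" "- 1"]
    by (auto simp: walk_steps_def affine_group_def)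
  have "finite (carrier (affine_group p))" by (simp add: affine_group_def)
  then have "(\<Sum>h\<in>carrier (affine_group p). count (walk_steps p g) h) = size (walk_steps p g)"
    unfolding size_multiset_overloaded_eq using sub
    by (intro sum.mono_neutral_right) (auto simp: not_in_iff)
  moreover have "size (walk_steps p g) = 5" by (simp add: walk_steps_def)
  ultimately have "(\<Sum>h\<in>carrier (affine_group p). real (count (walk_steps p g) h)) = 5"
    by (simp flip: of_nat_sum)
  then show ?thesis by (simp add: walk_measure_def flip: sum_divide_distrib)
qed

end

theory Submission
  imports Defs
begin

text \<open>
  The affine group is the semidirect product of the multiplicative group, which \<open>g\<close> turns into a cycle of
  length \<open>p - 1\<close>, with the group of translations. The projection \<open>(a, b) \<mapsto> a\<close> maps the walk to a lazy
  nearest-neighbour walk on this cycle, which needs order \<open>p\<^sup>2\<close> steps to mix. The point of the theorem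
  is that the translation part is much faster and does not slow the walk down.
  
  A Fourier transform in \<open>b\<close> writes the distribution after \<open>k\<close> steps as a superposition of modes, one for each frequency
  \<open>\<xi>\<close> modulo \<open>p\<close> (\<open>walk_eq_sum_modes\<close>). The mode at \<open>\<xi>\<close> is a function of \<open>a\<close> that evolves by the
  self-adjoint operator
  \<open>u(a) \<mapsto> ((1 + 2 cos (2 \<pi> \<xi> a / p)) u(a) + u(g a) + u(g\<inverse> a)) / 5\<close>.
  
  At \<open>\<xi> = 0\<close> this is the walk on the cycle, diagonalized by cosines (\<open>mode_0_pow_g\<close>). Its eigenvalues satisfy
  \<open>1 - \<lambda>\<^sub>j \<ge> c j\<^sup>2 / p\<^sup>2\<close> for \<open>j \<le> (p - 1) / 2\<close>, so the sum of their \<open>k\<close>-th powers decays like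
  \<open>exp (- c k / p\<^sup>2)\<close> once \<open>k \<ge> p\<^sup>2\<close> (\<open>sum_abs_mode_0_le\<close>), while the first one alone gives the lower
  bound (\<open>tv_lower_bound\<close>).
  
  At \<open>\<xi> \<noteq> 0\<close> the diagonal term loses mass except where \<open>\<xi> a\<close> is close to 0 modulo \<open>p\<close>. A bilinear exponential
  sum shows that a geometric progression with ratio \<open>g\<close> stays close to 0 for at most order \<open>\<surd>p\<close>
  consecutive steps (\<open>window_contains_phase_far_from_0\<close>). By a Poincare inequality along these windows the operator
  has norm at most \<open>1 - 1 / (360 p)\<close> (\<open>schrodinger_contracts\<close>, \<open>mode_contracts\<close>). All nonzero frequencies
  together therefore contribute at most \<open>p\<^sup>2 exp (- k / (360 p))\<close> to the distance, and for \<open>k \<ge> p\<^sup>2\<close> the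
  factor \<open>p\<^sup>2\<close> is absorbed by the exponential, as the exponent is at least of order \<open>p\<close>
  (\<open>tv_upper_bound\<close>). For \<open>k < p\<^sup>2\<close> the upper bound is trivial.
\<close>

section \<open>Cosines of residues\<close>

text \<open>
  Real parts of the additive characters of the integers modulo \<open>n\<close>. Cosines suffice: the walk is
  invariant under \<open>b \<mapsto> - b\<close> and its linear part under inversion, so all Fourier coefficients below
  are real.
\<close>
definition cosmod :: "nat \<Rightarrow> int \<Rightarrow> real" where
  "cosmod n t = cos (2 * pi * of_int t / of_nat n)"

lemma cosmod_0 [simp]: "cosmod n 0 = 1"
  by (simp add: cosmod_def)

lemma cosmod_uminus [simp]: "cosmod n (- t) = cosmod n t"
  by (simp add: cosmod_def)

lemma abs_cosmod_le_1: "\<bar>cosmod n t\<bar> \<le> 1"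
  by (simp add: cosmod_def)

lemma cosmod_add_diff: "cosmod n (t + s) + cosmod n (t - s) = 2 * cosmod n t * cosmod n s"
  by (simp add: cosmod_def ring_distribs diff_divide_distrib add_divide_distrib cos_add cos_diff)

lemma cosmod_cong:
  assumes "[s = t] (mod int n)" and n: "n > 0"
  shows "cosmod n s = cosmod n t"
proof -
  obtain q where q: "s = t + int n * q"
    using assms(1) by (metis cong_iff_lin cong_sym)
  have "2 * pi * of_int s / of_nat n = 2 * pi * of_int t / of_nat n + 2 * pi * of_int q"
    using n by (simp add: q field_simps)
  then show ?thesis
    unfolding cosmod_def by (simp add: cos_add)
qed

lemma cosmod_mod [simp]: "n > 0 \<Longrightarrow> cosmod n (t mod int n) = cosmod n t"
  by (rule cosmod_cong) (simp_all add: cong_def)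

lemma sum_cosmod:
  assumes n: "n > 0"
  shows "(\<Sum>x<n. cosmod n (t * int x)) = (if int n dvd t then real n else 0)"
proof (cases "int n dvd t")
  case True
  then have "cosmod n (t * int x) = 1" for x
    using cosmod_cong[of "t * int x" 0 n] n by (simp add: cong_0_iff)
  then show ?thesis using True by simp
next
  case False
  define \<theta> where "\<theta> = 2 * pi * of_int t / of_nat n"
  have tel: "2 * sin (\<theta> / 2) * (\<Sum>x<m. cos (\<theta> * real x))
      = sin (\<theta> * real m - \<theta> / 2) + sin (\<theta> / 2)" for m
  proof (induction m)
    case (Suc m)
    have "2 * sin (\<theta> / 2) * cos (\<theta> * real m)
        = sin (\<theta> * real m + \<theta> / 2) - sin (\<theta> * real m - \<theta> / 2)"
      by (simp add: sin_add sin_diff)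
    moreover have "\<theta> * real (Suc m) - \<theta> / 2 = \<theta> * real m + \<theta> / 2"
      by (simp add: algebra_simps)
    ultimately show ?case using Suc by (simp add: ring_distribs add.commute[of "\<theta> / 2"])
  qed simp
  have "\<theta> * real n = 2 * pi * of_int t" using n by (simp add: \<theta>_def)
  then have "sin (\<theta> * real n - \<theta> / 2) = - sin (\<theta> / 2)" by (simp add: sin_diff)
  then have "sin (\<theta> / 2) * (\<Sum>x<n. cos (\<theta> * real x)) = 0" using tel[of n] by simp
  moreover have "sin (\<theta> / 2) \<noteq> 0"
  proof
    assume "sin (\<theta> / 2) = 0"
    then obtain i :: int where "\<theta> / 2 = of_int i * pi" using sin_zero_iff_int2 by blast
    then have "real_of_int t = real_of_int (i * int n)"
      using n by (simp add: \<theta>_def field_simps)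
    then have "t = i * int n" by linarith
    then show False using False by simp
  qed
  ultimately have "(\<Sum>x<n. cos (\<theta> * real x)) = 0" by simp
  then show ?thesis using False by (simp add: cosmod_def \<theta>_def field_simps)
qed

lemma sum_cosmod_mult:
  assumes n: "n > 0"
  shows "(\<Sum>x<n. cosmod n (int x * s) * cosmod n (int x * t))
    = real n / 2 * (of_bool (int n dvd s + t) + of_bool (int n dvd s - t))"
proof -
  have "cosmod n (int x * s) * cosmod n (int x * t)
      = (cosmod n ((s + t) * int x) + cosmod n ((s - t) * int x)) / 2" for x
    using cosmod_add_diff[of n "int x * s" "int x * t"] by (simp add: algebra_simps)
  then have "(\<Sum>x<n. cosmod n (int x * s) * cosmod n (int x * t))
      = ((\<Sum>x<n. cosmod n ((s + t) * int x)) + (\<Sum>x<n. cosmod n ((s - t) * int x))) / 2"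
    by (simp only: sum.distrib flip: sum_divide_distrib)
  then show ?thesis unfolding sum_cosmod[OF n] by auto
qed

text \<open>
  The standard bilinear estimate: after Cauchy--Schwarz in \<open>h\<close> the outer sum is extended to all
  residues, where orthogonality leaves only the pairs \<open>z = y\<close> and \<open>z = - y\<close>. The bound beats the
  trivial one, \<open>card H * card Y\<close>, as soon as \<open>card H * card Y > p\<close>; this is what prevents a long
  piece of a geometric progression from staying near 0 modulo \<open>p\<close>.
\<close>
lemma bilinear_cosmod_sum_bound:
  assumes p: "p > 0" and H: "H \<subseteq> {0..<int p}" and Y: "Y \<subseteq> {0..<int p}"
  shows "(\<Sum>h\<in>H. \<Sum>y\<in>Y. cosmod p (h * y))\<^sup>2 \<le> real p * real (card H) * real (card Y)"
proof -
  have fin: "finite H" "finite Y" using H Y finite_subset by blast+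
  define S where "S h = (\<Sum>y\<in>Y. cosmod p (h * y))" for h
  have at_most_one: "(\<Sum>z\<in>Y. of_bool (int p dvd y + c * z)) \<le> (1 :: real)" if "c = 1 \<or> c = - 1" for y c
  proof -
    have "finite {z \<in> Y. int p dvd y + c * z}" using fin(2) by simp
    then have "card {z \<in> Y. int p dvd y + c * z} \<le> Suc 0"
    proof (subst card_le_Suc0_iff_eq, assumption, safe)
      fix z z' assume z: "z \<in> Y" "z' \<in> Y" and d: "int p dvd y + c * z" "int p dvd y + c * z'"
      have "int p dvd (y + c * z) - (y + c * z')" using d by (rule dvd_diff)
      then have "int p dvd z - z'" using that by (auto simp: dvd_diff_commute)
      then have "z mod int p = z' mod int p" by (simp add: mod_eq_dvd_iff)
      then show "z = z'" using z Y by (auto simp: subset_iff)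
    qed
    moreover have "(\<Sum>z\<in>Y. of_bool (int p dvd y + c * z)) = real (card {z \<in> Y. int p dvd y + c * z})"
      using fin by (simp add: sum.If_cases Int_def of_bool_def)
    ultimately show ?thesis by simp
  qed
  have "(\<Sum>x<p. (S (int x))\<^sup>2)
      = (\<Sum>x<p. \<Sum>y\<in>Y. \<Sum>z\<in>Y. cosmod p (int x * y) * cosmod p (int x * z))"
    by (simp add: S_def power2_eq_square sum_product)
  also have "\<dots> = (\<Sum>y\<in>Y. \<Sum>x<p. \<Sum>z\<in>Y. cosmod p (int x * y) * cosmod p (int x * z))"
    by (rule sum.swap)
  also have "\<dots> = (\<Sum>y\<in>Y. \<Sum>z\<in>Y. \<Sum>x<p. cosmod p (int x * y) * cosmod p (int x * z))"
    by (intro sum.cong refl sum.swap)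
  also have "\<dots> = (\<Sum>y\<in>Y. real p / 2 * ((\<Sum>z\<in>Y. of_bool (int p dvd y + 1 * z))
      + (\<Sum>z\<in>Y. of_bool (int p dvd y + (- 1) * z))))"
    unfolding sum_cosmod_mult[OF p]
    by (simp add: sum.distrib sum_distrib_left sum_divide_distrib distrib_left add_divide_distrib)
  also have "\<dots> \<le> (\<Sum>y\<in>Y. real p / 2 * (1 + 1))"
    by (intro sum_mono mult_left_mono add_mono at_most_one) auto
  finally have full: "(\<Sum>x<p. (S (int x))\<^sup>2) \<le> real p * real (card Y)" by (simp add: mult.commute)
  have "(\<Sum>h\<in>H. (S h)\<^sup>2) \<le> (\<Sum>h\<in>{0..<int p}. (S h)\<^sup>2)"
    using H by (intro sum_mono2) auto
  also have "\<dots> = (\<Sum>x<p. (S (int x))\<^sup>2)"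
    by (intro sum.reindex_bij_witness[of _ int nat]) auto
  finally have L2: "(\<Sum>h\<in>H. (S h)\<^sup>2) \<le> real p * real (card Y)" using full by simp
  have "(\<Sum>h\<in>H. S h)\<^sup>2 \<le> (\<Sum>h\<in>H. (S h)\<^sup>2) * real (card H)"
    using sum_squared_le_sum_of_squares[of S H] by simp
  also have "\<dots> \<le> real p * real (card Y) * real (card H)"
    using L2 by (intro mult_right_mono) auto
  finally show ?thesis by (simp add: S_def mult_ac)
qed

section \<open>Self-adjoint operators on orbits\<close>

text \<open>
  The operator norm of a self-adjoint operator is its numerical radius. Polarization with the vectors
  \<open>\<rho> u \<plusminus> T u\<close> replaces the spectral theorem.
\<close>
lemma selfadjoint_norm_le:
  fixes T :: "('a \<Rightarrow> real) \<Rightarrow> 'a \<Rightarrow> real"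
  assumes lin: "\<And>c u v x. T (\<lambda>y. c * u y + v y) x = c * T u x + T v x"
    and sym: "\<And>u v. (\<Sum>x\<in>X. T u x * v x) = (\<Sum>x\<in>X. u x * T v x)"
    and form: "\<And>u. \<bar>\<Sum>x\<in>X. u x * T u x\<bar> \<le> \<rho> * (\<Sum>x\<in>X. (u x)\<^sup>2)"
    and \<rho>: "\<rho> > 0"
  shows "(\<Sum>x\<in>X. (T u x)\<^sup>2) \<le> \<rho>\<^sup>2 * (\<Sum>x\<in>X. (u x)\<^sup>2)"
proof -
  define v where "v = T u"
  define N where "N w = (\<Sum>x\<in>X. (w x)\<^sup>2)" for w :: "'a \<Rightarrow> real"
  define q where "q w = (\<Sum>x\<in>X. w x * T w x)" for w
  have q: "q (\<lambda>x. c * u x + v x) = c\<^sup>2 * q u + 2 * c * N v + q v" for c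
  proof -
    have "q (\<lambda>x. c * u x + v x) = (\<Sum>x\<in>X. c\<^sup>2 * (u x * T u x) + c * (u x * T v x)
        + c * (T u x * v x) + v x * T v x)"
      unfolding q_def lin by (intro sum.cong refl) (simp add: algebra_simps power2_eq_square)
    also have "\<dots> = c\<^sup>2 * q u + c * (\<Sum>x\<in>X. u x * T v x) + c * (\<Sum>x\<in>X. T u x * v x) + q v"
      by (simp add: sum.distrib sum_distrib_left q_def)
    also have "(\<Sum>x\<in>X. u x * T v x) = N v"
      using sym[of u v] by (simp add: N_def v_def power2_eq_square)
    also have "(\<Sum>x\<in>X. T u x * v x) = N v" by (simp add: N_def v_def power2_eq_square)
    finally show ?thesis by simp
  qed
  have N: "N (\<lambda>x. \<rho> * u x + v x) + N (\<lambda>x. (- \<rho>) * u x + v x) = 2 * \<rho>\<^sup>2 * N u + 2 * N v"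
    unfolding N_def sum_distrib_left sum.distrib[symmetric]
    by (intro sum.cong refl) (simp add: algebra_simps power2_eq_square)
  \<comment> \<open>Polarization. The scaling of \<open>u\<close> by \<open>\<rho>\<close> balances the two terms of \<open>N\<close>: if \<open>\<rho>\<close> is the
    norm of \<open>T\<close> and \<open>u\<close> a top eigenvector, then \<open>\<rho> u\<close> and \<open>T u\<close> have the same length.\<close>
  have "4 * \<rho> * N v = q (\<lambda>x. \<rho> * u x + v x) - q (\<lambda>x. (- \<rho>) * u x + v x)"
    unfolding q by simp
  also have "\<dots> \<le> \<rho> * N (\<lambda>x. \<rho> * u x + v x) + \<rho> * N (\<lambda>x. (- \<rho>) * u x + v x)"
    using form[of "\<lambda>x. \<rho> * u x + v x"] form[of "\<lambda>x. (- \<rho>) * u x + v x"]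
    unfolding q_def[symmetric] N_def[symmetric] by (simp add: abs_le_iff)
  also have "\<dots> = \<rho> * (2 * \<rho>\<^sup>2 * N u + 2 * N v)" by (simp flip: N add: distrib_left)
  finally have "4 * N v \<le> 2 * \<rho>\<^sup>2 * N u + 2 * N v" using \<rho> by (simp add: mult.assoc mult.left_commute[of _ \<rho>])
  then show ?thesis by (simp add: N_def v_def)
qed

text \<open>
  A function with small gradient along \<open>\<sigma>\<close> and small \<open>V\<close>-mass is small: from each point at most
  \<open>m\<close> steps lead to a point where \<open>V\<close> controls the function, and by Cauchy--Schwarz the change of the
  function on the way is paid for by \<open>m\<close> times the gradient energy of the window.
\<close>
lemma poincare_on_orbits:
  fixes u V :: "'a \<Rightarrow> real"
  assumes bij: "bij_betw \<sigma> X X" and V: "\<And>x. x \<in> X \<Longrightarrow> V x \<ge> 0"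
    and hit: "\<And>x. x \<in> X \<Longrightarrow> \<exists>j<m. V ((\<sigma> ^^ j) x) \<ge> 1"
  shows "(\<Sum>x\<in>X. (u x)\<^sup>2) \<le> 2 * (real m)\<^sup>2 * (\<Sum>x\<in>X. V x * (u x)\<^sup>2 + (u (\<sigma> x) - u x)\<^sup>2)"
proof -
  define F where "F x = V x * (u x)\<^sup>2" for x
  define E where "E x = (u (\<sigma> x) - u x)\<^sup>2" for x
  have bijn: "bij_betw (\<sigma> ^^ i) X X" for i using bij by (rule bij_betw_funpow)
  have inX: "(\<sigma> ^^ i) x \<in> X" if "x \<in> X" for i x using bijn that by (rule bij_betwE[rule_format])
  \<comment> \<open>Every point of \<open>X\<close> lies in \<open>m\<close> of the windows, with multiplicity, so that summing over windows only costs a factor \<open>m\<close>.\<close>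
  have orbit: "(\<Sum>x\<in>X. \<Sum>i<m. G ((\<sigma> ^^ i) x)) = real m * (\<Sum>x\<in>X. G x)" for G :: "'a \<Rightarrow> real"
  proof -
    have "(\<Sum>x\<in>X. \<Sum>i<m. G ((\<sigma> ^^ i) x)) = (\<Sum>i<m. \<Sum>x\<in>X. G ((\<sigma> ^^ i) x))" by (rule sum.swap)
    also have "\<dots> = (\<Sum>i<m. \<Sum>x\<in>X. G x)" by (intro sum.cong refl sum.reindex_bij_betw bijn)
    finally show ?thesis by simp
  qed
  have pos: "F x \<ge> 0" "E x \<ge> 0" if "x \<in> X" for x using V that by (auto simp: F_def E_def)
  have local: "(u x)\<^sup>2 \<le> 2 * (\<Sum>i<m. F ((\<sigma> ^^ i) x)) + 2 * real m * (\<Sum>i<m. E ((\<sigma> ^^ i) x))"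
    if x: "x \<in> X" for x
  proof -
    obtain j where j: "j < m" "V ((\<sigma> ^^ j) x) \<ge> 1" using hit x by blast
    have "(u ((\<sigma> ^^ j) x))\<^sup>2 \<le> F ((\<sigma> ^^ j) x)"
      using mult_right_mono[OF j(2), of "(u ((\<sigma> ^^ j) x))\<^sup>2"] by (simp add: F_def)
    also have "\<dots> \<le> (\<Sum>i<m. F ((\<sigma> ^^ i) x))"
      using j(1) pos inX x by (intro member_le_sum) auto
    finally have 1: "(u ((\<sigma> ^^ j) x))\<^sup>2 \<le> (\<Sum>i<m. F ((\<sigma> ^^ i) x))" .
    have "u ((\<sigma> ^^ j) x) - u x = (\<Sum>i<j. u ((\<sigma> ^^ Suc i) x) - u ((\<sigma> ^^ i) x))"
      using sum_lessThan_telescope[of "\<lambda>i. u ((\<sigma> ^^ i) x)" j] by simp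
    then have "(u ((\<sigma> ^^ j) x) - u x)\<^sup>2 \<le> (\<Sum>i<j. E ((\<sigma> ^^ i) x)) * real (card {..<j})"
      using sum_squared_le_sum_of_squares[of "\<lambda>i. u ((\<sigma> ^^ Suc i) x) - u ((\<sigma> ^^ i) x)" "{..<j}"]
      by (simp add: E_def)
    also have "\<dots> \<le> (\<Sum>i<m. E ((\<sigma> ^^ i) x)) * real m"
      using j(1) pos inX x by (intro mult_mono sum_mono2 sum_nonneg) auto
    finally have 2: "(u ((\<sigma> ^^ j) x) - u x)\<^sup>2 \<le> real m * (\<Sum>i<m. E ((\<sigma> ^^ i) x))"
      by (simp add: mult.commute)
    have "(u x)\<^sup>2 \<le> 2 * (u ((\<sigma> ^^ j) x))\<^sup>2 + 2 * (u ((\<sigma> ^^ j) x) - u x)\<^sup>2"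
      using zero_le_power2[of "2 * u ((\<sigma> ^^ j) x) - u x"]
      by (simp add: power2_eq_square algebra_simps)
    then show ?thesis using 1 2 by linarith
  qed
  have "(\<Sum>x\<in>X. (u x)\<^sup>2) \<le> (\<Sum>x\<in>X. 2 * (\<Sum>i<m. F ((\<sigma> ^^ i) x))
      + 2 * real m * (\<Sum>i<m. E ((\<sigma> ^^ i) x)))"
    by (intro sum_mono local)
  also have "\<dots> = 2 * (\<Sum>x\<in>X. \<Sum>i<m. F ((\<sigma> ^^ i) x))
      + 2 * real m * (\<Sum>x\<in>X. \<Sum>i<m. E ((\<sigma> ^^ i) x))"
    by (simp add: sum.distrib sum_distrib_left)
  also have "\<dots> = 2 * real m * (\<Sum>x\<in>X. F x) + 2 * (real m)\<^sup>2 * (\<Sum>x\<in>X. E x)"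
    by (simp add: orbit power2_eq_square)
  also have "\<dots> \<le> 2 * (real m)\<^sup>2 * (\<Sum>x\<in>X. F x) + 2 * (real m)\<^sup>2 * (\<Sum>x\<in>X. E x)"
  proof -
    have "real m \<le> (real m)\<^sup>2" by (cases m) (auto simp: power2_eq_square)
    then show ?thesis using pos by (intro add_mono mult_mono sum_nonneg) auto
  qed
  finally show ?thesis by (simp add: F_def E_def sum.distrib distrib_left)
qed

text \<open>
  A discrete Schroedinger operator, up to an affine change: lazy hopping along the orbits of \<open>\<sigma>\<close>
  (with inverse \<open>\<tau>\<close>) and a diagonal term \<open>D\<close>. The factor \<open>1 / 5\<close> makes it a Markov operator if \<open>D = 3\<close>.
\<close>
definition schrodinger ::
    "('a \<Rightarrow> real) \<Rightarrow> ('a \<Rightarrow> 'a) \<Rightarrow> ('a \<Rightarrow> 'a) \<Rightarrow> ('a \<Rightarrow> real) \<Rightarrow> 'a \<Rightarrow> real" where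
  "schrodinger D \<sigma> \<tau> u x = (D x * u x + u (\<sigma> x) + u (\<tau> x)) / 5"

text \<open>
  The constant function would be an eigenvector for the eigenvalue 1 if \<open>D\<close> were 3 throughout. If every
  orbit segment of length \<open>m\<close> meets a point with \<open>D \<le> 2\<close>, then the Poincare inequality with potential
  \<open>3 - D\<close> opens a gap of order \<open>1 / m\<^sup>2\<close> at the top of the spectrum.
\<close>
lemma schrodinger_contracts:
  assumes bij: "bij_betw \<sigma> X X"
    and inv: "\<And>x. x \<in> X \<Longrightarrow> \<tau> (\<sigma> x) = x"
    and D: "\<And>x. x \<in> X \<Longrightarrow> - 1 \<le> D x \<and> D x \<le> 3"
    and hit: "\<And>x. x \<in> X \<Longrightarrow> \<exists>j<m. D ((\<sigma> ^^ j) x) \<le> 2"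
    and m: "m \<ge> 1"
  shows "(\<Sum>x\<in>X. (schrodinger D \<sigma> \<tau> u x)\<^sup>2)
    \<le> (1 - 1 / (10 * (real m)\<^sup>2))\<^sup>2 * (\<Sum>x\<in>X. (u x)\<^sup>2)"
proof (rule selfadjoint_norm_le)
  let ?T = "schrodinger D \<sigma> \<tau>"
  let ?l = "1 - 1 / (10 * (real m)\<^sup>2)"
  have shift: "(\<Sum>x\<in>X. u (\<tau> x) * v x) = (\<Sum>x\<in>X. u x * v (\<sigma> x))" for u v :: "'a \<Rightarrow> real"
    using sum.reindex_bij_betw[OF bij, of "\<lambda>x. u (\<tau> x) * v x"] inv by simp
  show "?T (\<lambda>y. c * u y + v y) x = c * ?T u x + ?T v x" for c u v x
    by (simp add: schrodinger_def field_simps)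
  show "(\<Sum>x\<in>X. ?T u x * v x) = (\<Sum>x\<in>X. u x * ?T v x)" for u v
  proof -
    have "(\<Sum>x\<in>X. ?T u x * v x) = (\<Sum>x\<in>X. D x * u x * v x / 5)
        + (\<Sum>x\<in>X. v x * u (\<sigma> x)) / 5 + (\<Sum>x\<in>X. u (\<tau> x) * v x) / 5"
      by (simp add: schrodinger_def add_divide_distrib sum.distrib sum_divide_distrib algebra_simps)
    also have "\<dots> = (\<Sum>x\<in>X. D x * u x * v x / 5)
        + (\<Sum>x\<in>X. v (\<tau> x) * u x) / 5 + (\<Sum>x\<in>X. u x * v (\<sigma> x)) / 5"
      by (simp only: shift)
    also have "\<dots> = (\<Sum>x\<in>X. u x * ?T v x)"
      by (simp add: schrodinger_def add_divide_distrib sum.distrib sum_divide_distrib algebra_simps)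
    finally show ?thesis .
  qed
  have m2: "(real m)\<^sup>2 \<ge> 1" using m by simp
  then have small: "1 / (10 * (real m)\<^sup>2) \<le> 1 / 10"
    by (intro frac_le) auto
  then show "?l > 0" by linarith
  show "\<bar>\<Sum>x\<in>X. u x * ?T u x\<bar> \<le> ?l * (\<Sum>x\<in>X. (u x)\<^sup>2)" for u
  proof -
    define N where "N = (\<Sum>x\<in>X. (u x)\<^sup>2)"
    have N0: "N \<ge> 0" by (simp add: N_def sum_nonneg)
    have Ns: "(\<Sum>x\<in>X. (u (\<sigma> x))\<^sup>2) = N"
      unfolding N_def by (rule sum.reindex_bij_betw[OF bij])
    have q: "5 * (\<Sum>x\<in>X. u x * ?T u x) = (\<Sum>x\<in>X. D x * (u x)\<^sup>2) + 2 * (\<Sum>x\<in>X. u x * u (\<sigma> x))"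
    proof -
      have "5 * (\<Sum>x\<in>X. u x * ?T u x) = (\<Sum>x\<in>X. D x * (u x)\<^sup>2) + (\<Sum>x\<in>X. u x * u (\<sigma> x))
          + (\<Sum>x\<in>X. u (\<tau> x) * u x)"
        unfolding sum_distrib_left sum.distrib[symmetric]
        by (intro sum.cong refl) (simp add: schrodinger_def algebra_simps power2_eq_square)
      then show ?thesis by (simp only: shift)
    qed
    \<comment> \<open>The Dirichlet form of the operator: its potential \<open>3 - D\<close> is at least 1 wherever \<open>D\<close> is at most 2.\<close>
    have "(\<Sum>x\<in>X. (3 - D x) * (u x)\<^sup>2 + (u (\<sigma> x) - u x)\<^sup>2)
        = 3 * N - (\<Sum>x\<in>X. D x * (u x)\<^sup>2) + ((\<Sum>x\<in>X. (u (\<sigma> x))\<^sup>2) - 2 * (\<Sum>x\<in>X. u x * u (\<sigma> x)) + N)"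
      unfolding N_def sum_distrib_left sum_subtractf[symmetric] sum.distrib[symmetric]
      by (intro sum.cong refl) (simp add: power2_diff algebra_simps)
    also have "\<dots> = 5 * (N - (\<Sum>x\<in>X. u x * ?T u x))" using q Ns by simp
    finally have "N \<le> 2 * (real m)\<^sup>2 * (5 * (N - (\<Sum>x\<in>X. u x * ?T u x)))"
      using poincare_on_orbits[OF bij, of "\<lambda>x. 3 - D x" m u] D hit
      by (simp add: N_def)
    then have "N \<le> (N - (\<Sum>x\<in>X. u x * ?T u x)) * (10 * (real m)\<^sup>2)"
      by (simp add: algebra_simps)
    moreover have "0 < 10 * (real m)\<^sup>2" using m2 by linarith
    ultimately have "N / (10 * (real m)\<^sup>2) \<le> N - (\<Sum>x\<in>X. u x * ?T u x)"
      by (simp only: pos_divide_le_eq)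
    then have upper: "(\<Sum>x\<in>X. u x * ?T u x) \<le> ?l * N" by (simp add: algebra_simps)
    \<comment> \<open>The other end of the spectrum is harmless: the quadratic form is at least \<open>(- 1 - 2) / 5\<close>.\<close>
    have "(\<Sum>x\<in>X. (- 1) * (u x)\<^sup>2) \<le> (\<Sum>x\<in>X. D x * (u x)\<^sup>2)"
      using D by (intro sum_mono mult_right_mono) auto
    then have "- N \<le> (\<Sum>x\<in>X. D x * (u x)\<^sup>2)" by (simp add: N_def sum_negf)
    moreover have "(\<Sum>x\<in>X. (u x + u (\<sigma> x))\<^sup>2) \<ge> 0" by (simp add: sum_nonneg)
    then have "N + 2 * (\<Sum>x\<in>X. u x * u (\<sigma> x)) + (\<Sum>x\<in>X. (u (\<sigma> x))\<^sup>2) \<ge> 0"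
      by (simp add: N_def power2_sum sum.distrib sum_distrib_left algebra_simps)
    ultimately have "- (3 / 5) * N \<le> (\<Sum>x\<in>X. u x * ?T u x)" using q Ns by linarith
    moreover have "3 / 5 * N \<le> ?l * N" using small N0 by (intro mult_right_mono) auto
    ultimately show ?thesis using upper by (simp add: N_def abs_le_iff)
  qed
qed

section \<open>Multiset sums and elementary inequalities\<close>

lemma sum_count_mult:
  fixes F :: "'a \<Rightarrow> real"
  assumes "finite A" "set_mset M \<subseteq> A"
  shows "(\<Sum>x\<in>A. real (count M x) * F x) = (\<Sum>x\<in>#M. F x)"
  using assms(2)
proof (induction M)
  case (add y M)
  have "(\<Sum>x\<in>A. real (count (add_mset y M) x) * F x)
      = (\<Sum>x\<in>A. (if x = y then F x else 0) + real (count M x) * F x)"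
    by (intro sum.cong) (auto simp: algebra_simps)
  then show ?case using add assms(1) by (simp add: sum.distrib sum.delta)
qed simp

text \<open>
  The constant 1/3 instead of \<open>2 / \<pi>\<close> is all that the cubic Taylor bound with \<open>x < 2\<close> gives, and
  it is enough here.
\<close>
lemma third_le_sin:
  fixes x :: real
  assumes "0 \<le> x" "x \<le> pi / 2"
  shows "x / 3 \<le> sin x"
proof -
  have "\<bar>sin x - (\<Sum>m<3. sin_coeff m * x ^ m)\<bar> \<le> inverse (fact 3) * \<bar>x\<bar> ^ 3"
    by (rule Maclaurin_sin_bound)
  then have cubic: "6 * \<bar>sin x - x\<bar> \<le> x ^ 3"
    using assms by (simp add: sin_coeff_def numeral_3_eq_3 fact_numeral field_simps)
  have "6 * (x - sin x) \<le> 6 * \<bar>sin x - x\<bar>" by (simp add: abs_if)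
  also note cubic
  also have "x ^ 3 \<le> 4 * x"
  proof -
    have "x ^ 2 \<le> 2 ^ 2" using assms pi_less_4 by (intro power_mono) auto
    then have "x * x ^ 2 \<le> x * 2 ^ 2" using assms by (intro mult_left_mono) auto
    then show ?thesis by (simp add: power3_eq_cube power2_eq_square)
  qed
  finally show ?thesis by simp
qed

text \<open>
  A converse to \<open>1 - x \<le> exp (- x)\<close> away from \<open>x = 1\<close>: apply \<open>1 + y \<le> exp y\<close> to \<open>y = x / (1 - x)\<close>,
  which is at most \<open>5 x\<close>.
\<close>
lemma exp_minus_5_mult_le:
  fixes x :: real
  assumes "0 \<le> x" "x \<le> 4 / 5"
  shows "exp (- (5 * x)) \<le> 1 - x"
proof -
  have "1 / (1 - x) = 1 + x / (1 - x)" using assms by (simp add: field_simps)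
  also have "\<dots> \<le> exp (x / (1 - x))" by (rule exp_ge_add_one_self)
  also have "x / (1 - x) \<le> 5 * x"
    using assms mult_left_mono[of "4 / 5" "1 - x" "x * 5"] by (simp add: divide_le_eq)
      (simp add: algebra_simps mult_le_cancel_left)
  finally have "1 / (1 - x) \<le> exp (5 * x)" by simp
  then show ?thesis using assms by (simp add: exp_minus field_simps)
qed

section \<open>The walk and its Fourier modes\<close>

locale affine_walk =
  fixes p g :: nat
  assumes prime_p: "prime p" and primroot: "residue_primroot p g" and g_less: "g < p"
begin

abbreviation "G \<equiv> affine_group p"

abbreviation "ginv \<equiv> modular_inverse (int p) (int g)"

abbreviation "units \<equiv> {1..int p - 1}"

abbreviation walk :: "nat \<Rightarrow> int \<times> int \<Rightarrow> real" where
  "walk \<equiv> conv_power G (walk_measure p g)"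

definition fwd :: "int \<Rightarrow> int" where
  "fwd a = (int g * a) mod int p"

definition bwd :: "int \<Rightarrow> int" where
  "bwd a = (ginv * a) mod int p"

lemma p_gt_1: "p > 1"
  using prime_p prime_gt_1_nat by blast

lemma coprime_g: "coprime (int g) (int p)"
  using primroot by (simp add: residue_primroot_def coprime_commute)

lemma ginv_g: "[ginv * int g = 1] (mod int p)" and g_ginv: "[int g * ginv = 1] (mod int p)"
  by (rule cong_modular_inverse2 cong_modular_inverse1; rule coprime_g)+

lemma mem_units_iff: "a mod int p \<in> units \<longleftrightarrow> \<not> int p dvd a"
proof -
  have "0 \<le> a mod int p" "a mod int p < int p" using p_gt_1 by auto
  moreover have "int p dvd a \<longleftrightarrow> a mod int p = 0" by (rule dvd_eq_mod_eq_0)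
  ultimately show ?thesis by (auto simp: order_le_less)
qed

lemma units_not_dvd: "a \<in> units \<Longrightarrow> \<not> int p dvd a"
  by (auto dest: zdvd_imp_le)

lemma g_mem_units: "int g \<in> units"
proof -
  have "g \<noteq> 0" using coprime_g p_gt_1 by (cases g) auto
  then show ?thesis using g_less by auto
qed

lemma not_dvd_g_power: "\<not> int p dvd int g ^ i"
proof -
  have "prime (int p)" using prime_p by simp
  then show ?thesis using prime_dvd_power units_not_dvd[OF g_mem_units] by blast
qed

lemma ginv_mem_units: "ginv \<in> units"
proof -
  have "ginv > 0" using p_gt_1 coprime_g by (intro mult_modular_inverse_int_pos) auto
  moreover have "ginv < int p" using p_gt_1 by (intro modular_inverse_int_less) auto
  ultimately show ?thesis by simp
qed

lemma mult_mod_mem_units: "a \<in> units \<Longrightarrow> b \<in> units \<Longrightarrow> (a * b) mod int p \<in> units"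
  using units_not_dvd prime_p unfolding mem_units_iff by (auto simp: prime_dvd_mult_iff)

lemma fwd_mem: "a \<in> units \<Longrightarrow> fwd a \<in> units" and bwd_mem: "a \<in> units \<Longrightarrow> bwd a \<in> units"
  unfolding fwd_def bwd_def
  using mult_mod_mem_units g_mem_units ginv_mem_units by blast+

lemma bwd_fwd: "a \<in> units \<Longrightarrow> bwd (fwd a) = a" and fwd_bwd: "a \<in> units \<Longrightarrow> fwd (bwd a) = a"
proof -
  assume a: "a \<in> units"
  have "[ginv * int g * a = 1 * a] (mod int p)" by (intro cong_mult ginv_g cong_refl)
  then show "bwd (fwd a) = a" using a by (simp add: bwd_def fwd_def cong_def mod_simps mult.assoc)
  have "[int g * ginv * a = 1 * a] (mod int p)" by (intro cong_mult g_ginv cong_refl)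
  then show "fwd (bwd a) = a" using a by (simp add: bwd_def fwd_def cong_def mod_simps mult.assoc)
qed

lemma bij_fwd: "bij_betw fwd units units"
  by (rule bij_betw_byWitness[of _ bwd]) (use fwd_mem bwd_mem bwd_fwd fwd_bwd in auto)

lemma fwd_funpow: "a \<in> units \<Longrightarrow> (fwd ^^ i) a = (int g ^ i * a) mod int p"
  by (induction i) (auto simp: fwd_def mod_simps mult.assoc)

lemma carrier_G: "carrier G = units \<times> {0..int p - 1}"
  by (simp add: affine_group_def)

lemma one_G: "\<one>\<^bsub>G\<^esub> = (1, 0)"
  by (simp add: affine_group_def)

lemma group_G: "group G"
  using prime_p by (rule affine_group_is_group)

text \<open>
  With exponent 0 read as the point mass at the identity, the recursion also holds for the first step,
  so that all inductions below can start at 0.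
\<close>
lemma walk_Suc_conv:
  assumes h: "h \<in> carrier G"
  shows "walk (Suc k) h = (\<Sum>s\<in>carrier G. walk_measure p g s * walk k (h \<otimes>\<^bsub>G\<^esub> inv\<^bsub>G\<^esub> s))"
proof (cases k)
  case 0
  interpret group G by (rule group_G)
  have "h \<otimes>\<^bsub>G\<^esub> inv\<^bsub>G\<^esub> s = \<one>\<^bsub>G\<^esub> \<longleftrightarrow> s = h" if "s \<in> carrier G" for s
    using that h inv_solve_right'[OF one_closed h that] by auto
  then have "(\<Sum>s\<in>carrier G. walk_measure p g s * walk 0 (h \<otimes>\<^bsub>G\<^esub> inv\<^bsub>G\<^esub> s))
      = (\<Sum>s\<in>carrier G. if s = h then walk_measure p g s else 0)"
    by (intro sum.cong) auto
  also have "\<dots> = walk_measure p g h"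
    using h by (simp add: carrier_G)
  finally show ?thesis using 0 by simp
qed simp

text \<open>
  Right multiplication by a step \<open>(1, c)\<close> moves \<open>b\<close> by \<open>a c\<close>, and by \<open>(c, 0)\<close> multiplies \<open>a\<close> by \<open>c\<close>. The
  translation steps therefore act diagonally after a Fourier transform in \<open>b\<close>.
\<close>
lemma walk_Suc:
  assumes a: "a \<in> units" and b: "b \<in> {0..int p - 1}"
  shows "walk (Suc k) (a, b) = (walk k (a, b) + walk k (a, (b - a) mod int p)
      + walk k (a, (b + a) mod int p) + walk k (bwd a, b) + walk k (fwd a, b)) / 5"
proof -
  interpret group G by (rule group_G)
  let ?F = "\<lambda>s. walk k ((a, b) \<otimes>\<^bsub>G\<^esub> inv\<^bsub>G\<^esub> s)"
  have h: "(a, b) \<in> carrier G" using a b by (simp add: carrier_G)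
  have m: "x mod int p \<in> {0..int p - 1}" for x using p_gt_1 pos_mod_bound[of "int p" x] by simp
  \<comment> \<open>Solving for the predecessor of \<open>(a, b)\<close> under each step avoids computing inverses in the group.\<close>
  have div: "(a, b) \<otimes>\<^bsub>G\<^esub> inv\<^bsub>G\<^esub> s = x"
    if "s \<in> carrier G" "x \<in> carrier G" "x \<otimes>\<^bsub>G\<^esub> s = (a, b)" for s x
    using inv_solve_right'[OF that(2) h that(1)] that(3) by simp
  have one_units: "1 \<in> units" using p_gt_1 by simp
  have a_mod: "a mod int p = a" and b_mod: "b mod int p = b" using a b by auto
  have 1: "(a, b) \<otimes>\<^bsub>G\<^esub> inv\<^bsub>G\<^esub> (1, 0) = (a, b)"
    using a b a_mod b_mod one_units by (intro div) (auto simp: affine_group_def)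
  have 2: "(a, b) \<otimes>\<^bsub>G\<^esub> inv\<^bsub>G\<^esub> (1, 1) = (a, (b - a) mod int p)"
    using a b a_mod b_mod one_units m[of "b - a"]
    by (intro div) (auto simp: affine_group_def mod_simps)
  have 3: "(a, b) \<otimes>\<^bsub>G\<^esub> inv\<^bsub>G\<^esub> (1, (- 1) mod int p) = (a, (b + a) mod int p)"
  proof (intro div)
    show "(1, (- 1) mod int p) \<in> carrier G" "(a, (b + a) mod int p) \<in> carrier G"
      using a one_units m[of "b + a"] m[of "- 1"] by (auto simp: carrier_G)
    have "[a * ((- 1) mod int p) + (b + a) mod int p = a * (- 1) + (b + a)] (mod int p)"
      by (intro cong_add cong_mult) (simp_all add: cong_def)
    then show "(a, (b + a) mod int p) \<otimes>\<^bsub>G\<^esub> (1, (- 1) mod int p) = (a, b)"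
      using a_mod b_mod by (simp add: affine_group_def cong_def)
  qed
  have 4: "(a, b) \<otimes>\<^bsub>G\<^esub> inv\<^bsub>G\<^esub> (int g, 0) = (bwd a, b)"
    using b b_mod g_mem_units bwd_mem[OF a] fwd_bwd[OF a]
    by (intro div) (auto simp: affine_group_def fwd_def mult.commute)
  have 5: "(a, b) \<otimes>\<^bsub>G\<^esub> inv\<^bsub>G\<^esub> (ginv, 0) = (fwd a, b)"
    using b b_mod ginv_mem_units fwd_mem[OF a] bwd_fwd[OF a]
    by (intro div) (auto simp: affine_group_def bwd_def mult.commute)
  have sub: "set_mset (walk_steps p g) \<subseteq> carrier G"
    using g_mem_units ginv_mem_units m[of "- 1"] p_gt_1 by (auto simp: walk_steps_def carrier_G)
  have "walk (Suc k) (a, b) = (\<Sum>s\<in>carrier G. real (count (walk_steps p g) s) * ?F s) / 5"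
    by (simp add: walk_Suc_conv[OF h] walk_measure_def sum_divide_distrib)
  also have "(\<Sum>s\<in>carrier G. real (count (walk_steps p g) s) * ?F s) = (\<Sum>s\<in>#walk_steps p g. ?F s)"
    using sub by (intro sum_count_mult) (simp_all add: carrier_G)
  finally show ?thesis by (simp add: walk_steps_def 1 2 3 4 5 add.assoc)
qed

text \<open>
  The Fourier coefficient of the \<open>k\<close>-th convolution power in the variable \<open>b\<close> at frequency \<open>\<xi>\<close>. It is
  defined by the recursion that the Fourier transform turns the convolution into; that it gives the
  coefficients is \<open>walk_eq_sum_modes\<close>.
\<close>
definition mode :: "int \<Rightarrow> nat \<Rightarrow> int \<Rightarrow> real" where
  "mode \<xi> k = (schrodinger (\<lambda>a. 1 + 2 * cosmod p (\<xi> * a)) fwd bwd ^^ k) (\<lambda>a. if a = 1 then 1 else 0)"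

lemma mode_0: "mode \<xi> 0 a = (if a = 1 then 1 else 0)"
  by (simp add: mode_def)

lemma mode_Suc: "mode \<xi> (Suc k) = schrodinger (\<lambda>a. 1 + 2 * cosmod p (\<xi> * a)) fwd bwd (mode \<xi> k)"
  by (simp add: mode_def)

text \<open>
  Fourier inversion, by induction on \<open>k\<close>: the two translation steps shift \<open>b\<close> by \<open>\<plusminus> a\<close>, which multiplies
  the coefficient at \<open>\<xi>\<close> by \<open>2 cos (2 \<pi> \<xi> a / p)\<close>.
\<close>
lemma walk_eq_sum_modes:
  assumes "a \<in> units" "b \<in> {0..int p - 1}"
  shows "walk k (a, b) = (\<Sum>\<xi><p. mode (int \<xi>) k a * cosmod p (int \<xi> * b)) / real p"
  using assms
proof (induction k arbitrary: a b)
  case 0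
  have "(\<Sum>\<xi><p. cosmod p (int \<xi> * b)) = (if int p dvd b then real p else 0)"
    using sum_cosmod[of p b] p_gt_1 by (simp add: mult.commute)
  moreover have "int p dvd b \<longleftrightarrow> b = 0" using 0(2) by (auto dest: zdvd_imp_le)
  ultimately show ?case using p_gt_1 by (simp add: mode_0 one_G)
next
  case (Suc k)
  have m: "x mod int p \<in> {0..int p - 1}" for x using p_gt_1 pos_mod_bound[of "int p" x] by simp
  have cm: "cosmod p (\<xi> * (x mod int p)) = cosmod p (\<xi> * x)" for \<xi> x
    using p_gt_1 by (intro cosmod_cong) (simp_all add: cong_def mod_simps)
  have step: "mode \<xi> k a * cosmod p (\<xi> * b) + mode \<xi> k a * cosmod p (\<xi> * (b - a))
      + mode \<xi> k a * cosmod p (\<xi> * (b + a)) + mode \<xi> k (bwd a) * cosmod p (\<xi> * b)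
      + mode \<xi> k (fwd a) * cosmod p (\<xi> * b) = 5 * (mode \<xi> (Suc k) a * cosmod p (\<xi> * b))" for \<xi>
  proof -
    have sum: "cosmod p (\<xi> * (b - a))
        = 2 * cosmod p (\<xi> * b) * cosmod p (\<xi> * a) - cosmod p (\<xi> * (b + a))"
      using cosmod_add_diff[of p "\<xi> * b" "\<xi> * a"] unfolding distrib_left right_diff_distrib by simp
    show ?thesis unfolding sum mode_Suc schrodinger_def by (simp add: field_simps)
  qed
  let ?S = "\<lambda>a b. (\<Sum>\<xi><p. mode (int \<xi>) k a * cosmod p (int \<xi> * b))"
  have IH: "walk k (a', b' mod int p) * real p = ?S a' b'" if "a' \<in> units" for a' b'
    using Suc.IH[OF that m] p_gt_1 by (simp add: cm)
  have "walk (Suc k) (a, b) * (5 * real p)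
      = ?S a b + ?S a (b - a) + ?S a (b + a) + ?S (bwd a) b + ?S (fwd a) b"
    using IH[OF Suc.prems(1), of b] IH[OF Suc.prems(1), of "b - a"] IH[OF Suc.prems(1), of "b + a"]
      IH[OF bwd_mem[OF Suc.prems(1)], of b] IH[OF fwd_mem[OF Suc.prems(1)], of b] Suc.prems(2)
    by (simp add: walk_Suc[OF Suc.prems] distrib_right mult.left_commute[of _ 5])
  also have "\<dots> = 5 * (\<Sum>\<xi><p. mode (int \<xi>) (Suc k) a * cosmod p (int \<xi> * b))"
    unfolding sum.distrib[symmetric] step sum_distrib_left ..
  finally show ?case using p_gt_1 by (simp add: field_simps)
qed

section \<open>Decay at nonzero frequencies\<close>

text \<open>
  A window of order \<open>\<surd>p\<close> consecutive terms of the geometric progression \<open>\<xi> a g\<^sup>j\<close> contains a residue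
  whose cosine is at most 1/2. Otherwise the set of products of two progressions of length \<open>M\<close> would lie in
  the window and give a bilinear sum of size at least \<open>M\<^sup>2 / 2\<close>, against the bound
  \<open>\<surd>p M\<close>. The trivial window length \<open>p - 1\<close> would only give a spectral gap of order \<open>1 / p\<^sup>2\<close>, which
  is too weak by a logarithm to absorb the number \<open>p (p - 1)\<close> of group elements.
\<close>
lemma window_contains_phase_far_from_0:
  assumes \<xi>: "\<not> int p dvd \<xi>" and a: "a \<in> units" and M: "4 * p \<le> M\<^sup>2"
  shows "\<exists>j<2 * M. cosmod p (\<xi> * (fwd ^^ j) a) \<le> 1 / 2"
proof (rule ccontr)
  assume "\<not> ?thesis"
  then have small: "cosmod p (\<xi> * (fwd ^^ j) a) > 1 / 2" if "j < 2 * M" for j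
    using that by force
  define y where "y i = (\<xi> * a * int g ^ i) mod int p" for i
  define h where "h i = int (g ^ i mod p)" for i
  define m where "m = min M (p - 1)"
  have nd: "\<not> int p dvd \<xi> * a" using \<xi> units_not_dvd[OF a] prime_p by (simp add: prime_dvd_mult_iff)
  have cop: "coprime (\<xi> * a) (int p)"
    using prime_imp_coprime[OF _ nd] prime_p by (simp add: coprime_commute)
  have M0: "M > 0" using M p_gt_1 by (cases M) auto
  have phase: "cosmod p (\<xi> * a * int g ^ j) > 1 / 2" if "j < 2 * M" for j
  proof -
    have "cosmod p (\<xi> * (fwd ^^ j) a) = cosmod p (\<xi> * a * int g ^ j)"
      using p_gt_1 a by (intro cosmod_cong) (simp_all add: fwd_funpow cong_def mod_simps mult_ac)
    then show ?thesis using small[OF that] by simp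
  qed
  have gen: "inj_on (\<lambda>i. g ^ i mod p) {..<p - 1}"
    using residue_primroot_is_generator[OF p_gt_1 primroot] prime_p
    by (simp add: bij_betw_def totient_prime)
  then have inj_h: "inj_on h {..<m}"
    unfolding h_def by (intro inj_onI) (auto simp: m_def dest: inj_onD)
  have inj_y: "inj_on y {..<m}"
  proof (rule inj_onI)
    fix i j assume ij: "i \<in> {..<m}" "j \<in> {..<m}" "y i = y j"
    then have "[int (g ^ i) = int (g ^ j)] (mod int p)"
      using cong_mult_lcancel[OF cop] by (simp add: y_def cong_def)
    then have "[g ^ i = g ^ j] (mod p)" using cong_int_iff by blast
    then have "g ^ i mod p = g ^ j mod p" by (simp add: cong_def)
    then show "i = j" using gen ij by (auto simp: m_def dest: inj_onD)
  qed
  have y_units: "y i \<in> units" for i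
  proof -
    have "\<not> int p dvd \<xi> * a * int g ^ i"
      using nd not_dvd_g_power prime_dvd_mult_iff[of "int p" "\<xi> * a" "int g ^ i"] prime_p by auto
    then show ?thesis by (simp only: y_def mem_units_iff not_False_eq_True)
  qed
  show False
  proof (cases "p - 1 \<le> M")
    case True
    then have mp: "m = p - 1" by (simp add: m_def)
    have "y ` {..<m} = units"
      using inj_y y_units by (intro card_subset_eq) (auto simp: card_image mp)
    then have bij: "bij_betw y {..<m} units" using inj_y by (simp add: bij_betw_def)
    \<comment> \<open>The window now runs through all nonzero residues, over which the cosines sum to -1.\<close>
    have "(\<Sum>x<p. cosmod p (1 * int x)) = 0"
      using sum_cosmod[of p 1] p_gt_1 by (simp add: zdvd1_eq)
    moreover have "(\<Sum>x<p. cosmod p (1 * int x)) = (\<Sum>x\<in>{0..int p - 1}. cosmod p x)"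
      by (intro sum.reindex_bij_witness[of _ nat int]) auto
    moreover have "{0..int p - 1} = insert 0 units" using p_gt_1 by auto
    ultimately have "(\<Sum>x\<in>units. cosmod p x) = - 1" by simp
    moreover have "(\<Sum>i<m. cosmod p (y i)) = (\<Sum>x\<in>units. cosmod p x)"
      by (rule sum.reindex_bij_betw[OF bij])
    moreover have "(\<Sum>i<m. cosmod p (y i)) \<ge> 0"
    proof (intro sum_nonneg)
      fix i assume "i \<in> {..<m}"
      then have "cosmod p (\<xi> * a * int g ^ i) > 1 / 2" by (intro phase) (simp add: m_def)
      then show "cosmod p (y i) \<ge> 0" using p_gt_1 by (simp add: y_def)
    qed
    ultimately show False by simp
  next
    case False
    then have mM: "m = M" by (simp add: m_def)
    have sub: "h ` {..<m} \<subseteq> {0..<int p}" "y ` {..<m} \<subseteq> {0..<int p}"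
      using y_units p_gt_1 by (auto simp: h_def y_def)
    \<comment> \<open>Every product of a power of \<open>g\<close> below \<open>M\<close> with a point in the first half of the window lies
      in the window, so all \<open>M\<^sup>2\<close> terms of the bilinear sum exceed 1/2.\<close>
    let ?S = "\<Sum>u\<in>h ` {..<m}. \<Sum>v\<in>y ` {..<m}. cosmod p (u * v)"
    have S: "?S = (\<Sum>i<m. \<Sum>j<m. cosmod p (\<xi> * a * int g ^ (i + j)))"
    proof -
      have "cosmod p (h i * y j) = cosmod p (\<xi> * a * int g ^ (i + j))" for i j
      proof (rule cosmod_cong)
        have "[h i * y j = int g ^ i * (\<xi> * a * int g ^ j)] (mod int p)"
          by (intro cong_mult) (simp_all add: h_def y_def cong_def zmod_int)
        then show "[h i * y j = \<xi> * a * int g ^ (i + j)] (mod int p)"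
          by (simp add: power_add mult_ac)
      qed (use p_gt_1 in simp)
      then show ?thesis using inj_h inj_y by (simp add: sum.reindex)
    qed
    have "(\<Sum>i<m. \<Sum>j<m. 1 / 2 :: real) < ?S"
      unfolding S using M0 mM by (intro sum_strict_mono phase) auto
    then have "(real M)\<^sup>2 / 2 < ?S" by (simp add: mM power2_eq_square)
    then have "((real M)\<^sup>2 / 2)\<^sup>2 < ?S\<^sup>2" by (intro power_strict_mono) auto
    also have "\<dots> \<le> real p * (real M)\<^sup>2"
      using bilinear_cosmod_sum_bound[OF _ sub] p_gt_1 inj_h inj_y
      by (simp add: card_image mM power2_eq_square mult.assoc)
    finally have "(real M)\<^sup>2 * (real M)\<^sup>2 < 4 * real p * (real M)\<^sup>2"
      by (simp add: power2_eq_square)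
    then have "(real M)\<^sup>2 < 4 * real p" using M0
      by (simp only: mult_less_cancel_right_pos zero_less_power of_nat_0_less_iff)
    moreover have "real (4 * p) \<le> real (M\<^sup>2)" using M by (simp only: of_nat_le_iff)
    ultimately show False by simp
  qed
qed

text \<open>
  At a nonzero frequency the spectral gap is of order \<open>1 / p\<close>, far more than the \<open>1 / p\<^sup>2\<close> of the
  cyclic walk at frequency 0.
\<close>
lemma mode_contracts:
  assumes \<xi>: "\<not> int p dvd \<xi>"
  shows "(\<Sum>a\<in>units. (mode \<xi> k a)\<^sup>2) \<le> ((1 - 1 / (360 * real p)) ^ k)\<^sup>2"
proof (induction k)
  case 0
  show ?case using p_gt_1 by (simp add: mode_0 if_distrib[of "\<lambda>x. x\<^sup>2"] cong: if_cong)
next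
  case (Suc k)
  define s where "s = sqrt (real p)"
  \<comment> \<open>About \<open>2 \<surd>p\<close> is the least half-length that the window lemma admits. The window has length
    \<open>2 M \<le> 6 \<surd>p\<close>, and \<open>10 (6 \<surd>p)\<^sup>2 = 360 p\<close>.\<close>
  define M where "M = nat \<lceil>2 * s\<rceil>"
  let ?D = "\<lambda>a. 1 + 2 * cosmod p (\<xi> * a)"
  let ?r = "1 - 1 / (360 * real p)"
  have s: "s \<ge> 1" "s\<^sup>2 = real p" using p_gt_1 by (auto simp: s_def)
  have Ms: "real M \<ge> 2 * s" "real M \<le> 3 * s" using s(1) unfolding M_def by linarith+
  have "(real M)\<^sup>2 \<ge> (2 * s)\<^sup>2" "(real M)\<^sup>2 \<le> (3 * s)\<^sup>2"
    using Ms s(1) by (intro power_mono; simp)+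
  then have M2: "(real M)\<^sup>2 \<ge> 4 * real p" "(real M)\<^sup>2 \<le> 9 * real p" by (simp_all add: s(2) power_mult_distrib)
  then have "real (4 * p) \<le> real (M\<^sup>2)" by simp
  then have M4: "4 * p \<le> M\<^sup>2" by (simp only: of_nat_le_iff)
  have "M > 0" using M4 p_gt_1 by (cases M) auto
  have "(\<Sum>a\<in>units. (mode \<xi> (Suc k) a)\<^sup>2)
      \<le> (1 - 1 / (10 * (real (2 * M))\<^sup>2))\<^sup>2 * (\<Sum>a\<in>units. (mode \<xi> k a)\<^sup>2)"
    unfolding mode_Suc
  proof (rule schrodinger_contracts[OF bij_fwd bwd_fwd])
    show "- 1 \<le> ?D a \<and> ?D a \<le> 3" for a using abs_cosmod_le_1[of p "\<xi> * a"] by auto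
    show "\<exists>j<2 * M. ?D ((fwd ^^ j) a) \<le> 2" if a: "a \<in> units" for a
      using window_contains_phase_far_from_0[OF \<xi> a M4] by force
  qed (use \<open>M > 0\<close> in auto)
  also have "\<dots> \<le> ?r\<^sup>2 * (?r ^ k)\<^sup>2"
  proof (intro mult_mono power_mono Suc.IH sum_nonneg)
    have "10 * (real (2 * M))\<^sup>2 \<ge> 1" using \<open>M > 0\<close> M2(1) p_gt_1 by simp
    then show "0 \<le> 1 - 1 / (10 * (real (2 * M))\<^sup>2)"
      using \<open>M > 0\<close> by (simp add: divide_le_eq)
    show "1 - 1 / (10 * (real (2 * M))\<^sup>2) \<le> ?r"
      using M2 \<open>M > 0\<close> p_gt_1 by (simp add: frac_le)
  qed auto
  finally show ?case by (simp add: power_mult_distrib)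
qed

lemma abs_mode_le:
  assumes "\<not> int p dvd \<xi>" "a \<in> units"
  shows "\<bar>mode \<xi> k a\<bar> \<le> exp (- (real k / (360 * real p)))"
proof -
  let ?r = "1 - 1 / (360 * real p)"
  have r0: "?r \<ge> 0" using p_gt_1 by simp
  have "(mode \<xi> k a)\<^sup>2 \<le> (\<Sum>a\<in>units. (mode \<xi> k a)\<^sup>2)"
    using assms(2) by (intro member_le_sum) auto
  also have "\<dots> \<le> (?r ^ k)\<^sup>2" by (rule mode_contracts[OF assms(1)])
  finally have "\<bar>mode \<xi> k a\<bar> \<le> \<bar>?r ^ k\<bar>" by (simp only: abs_le_square_iff)
  also have "\<bar>?r ^ k\<bar> = ?r ^ k" using r0 by (simp only: abs_of_nonneg zero_le_power)
  also have "\<dots> \<le> exp (- (1 / (360 * real p))) ^ k"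
    using r0 exp_ge_add_one_self[of "- (1 / (360 * real p))"] by (intro power_mono) auto
  also have "\<dots> = exp (- (real k / (360 * real p)))" by (simp flip: exp_of_nat_mult)
  finally show ?thesis .
qed

section \<open>The frequency zero: a walk on the cycle\<close>

text \<open>
  The order of \<open>g\<close>. The exponent of \<open>g\<close> turns the multiplicative group into a cycle of this length.
\<close>
definition n :: nat where
  "n = p - 1"

definition pow_g :: "nat \<Rightarrow> int" where
  "pow_g i = int (g ^ i mod p)"

definition eigenvalue :: "nat \<Rightarrow> real" where
  "eigenvalue j = (3 + 2 * cosmod n (int j)) / 5"

lemma n_pos: "n > 0" and of_nat_n: "real n = real p - 1"
  using p_gt_1 by (auto simp: n_def)

lemma bij_pow_g: "bij_betw pow_g {..<n} units"
proof -
  have "bij_betw (\<lambda>i. g ^ i mod p) {..<n} {0<..<p}"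
    using residue_primroot_is_generator[OF p_gt_1 primroot] prime_p
    by (simp add: totient_prime totatives_prime n_def)
  moreover have "bij_betw int {0<..<p} units"
    by (rule bij_betw_byWitness[of _ nat]) auto
  ultimately have "bij_betw (int \<circ> (\<lambda>i. g ^ i mod p)) {..<n} units" by (rule bij_betw_trans)
  moreover have "int \<circ> (\<lambda>i. g ^ i mod p) = pow_g" by (auto simp: pow_g_def)
  ultimately show ?thesis by simp
qed

lemma ord_g: "ord p g = n"
  using primroot prime_p by (simp add: residue_primroot_def totient_prime n_def)

lemma pow_g_mem: "pow_g i \<in> units"
  using mem_units_iff[of "int g ^ i"] not_dvd_g_power by (simp add: pow_g_def zmod_int)

lemma pow_g_eq_1_iff: "pow_g i = 1 \<longleftrightarrow> n dvd i"
proof -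
  have "pow_g i = 1 \<longleftrightarrow> [g ^ i = 1] (mod p)"
    using p_gt_1 of_nat_eq_1_iff[of "g ^ i mod p", where ?'a = int] by (simp add: pow_g_def cong_def)
  then show ?thesis using ord_divides[of g i p] by (simp add: ord_g)
qed

lemma fwd_pow_g: "fwd (pow_g i) = pow_g (Suc i)"
  by (simp add: fwd_def pow_g_def zmod_int mod_simps)

lemma pow_g_add_n: "pow_g (i + n) = pow_g i"
proof -
  have "[g ^ n = 1] (mod p)" using ord_divides[of g n p] by (simp add: ord_g)
  then have "[g ^ i * g ^ n = g ^ i * 1] (mod p)" by (intro cong_mult) auto
  then show ?thesis by (simp add: pow_g_def power_add cong_def)
qed

lemma bwd_pow_g: "bwd (pow_g i) = pow_g (i + n - 1)"
proof -
  have "fwd (pow_g (i + n - 1)) = pow_g i" using n_pos by (simp add: fwd_pow_g pow_g_add_n)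
  then show ?thesis using bwd_fwd[OF pow_g_mem, of "i + n - 1"] by simp
qed

text \<open>
  At frequency 0 the recursion is the one of the lazy simple random walk on the cycle, which the
  characters of the cycle diagonalize.
\<close>
lemma mode_0_pow_g:
  "mode 0 k (pow_g i) = (\<Sum>j<n. eigenvalue j ^ k * cosmod n (int i * int j)) / real n"
proof (induction k arbitrary: i)
  case 0
  show ?case using sum_cosmod[OF n_pos, of "int i"] n_pos
    by (simp add: mode_0 pow_g_eq_1_iff)
next
  case (Suc k)
  have step: "3 * (eigenvalue j ^ k * cosmod n (int i * int j))
      + eigenvalue j ^ k * cosmod n (int (Suc i) * int j)
      + eigenvalue j ^ k * cosmod n (int (i + n - 1) * int j)
    = 5 * (eigenvalue j ^ Suc k * cosmod n (int i * int j))" for j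
  proof -
    have "cosmod n (int (i + n - 1) * int j) = cosmod n (int i * int j - int j)"
    proof (rule cosmod_cong[OF _ n_pos])
      have "int (i + n - 1) * int j = int i * int j - int j + int n * int j"
        using n_pos by (simp add: of_nat_diff algebra_simps)
      then show "[int (i + n - 1) * int j = int i * int j - int j] (mod int n)"
        by (simp add: cong_def)
    qed
    moreover have "int (Suc i) * int j = int i * int j + int j" by (simp add: algebra_simps)
    ultimately have sum: "cosmod n (int (Suc i) * int j)
        = 2 * cosmod n (int i * int j) * cosmod n (int j) - cosmod n (int (i + n - 1) * int j)"
      using cosmod_add_diff[of n "int i * int j" "int j"] by simp
    have "5 * (eigenvalue j ^ Suc k * cosmod n (int i * int j))
        = (5 * eigenvalue j) * (eigenvalue j ^ k * cosmod n (int i * int j))" by simp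
    also have "5 * eigenvalue j = 3 + 2 * cosmod n (int j)" by (simp add: eigenvalue_def)
    finally show ?thesis unfolding sum by (simp add: algebra_simps)
  qed
  have "mode 0 (Suc k) (pow_g i)
      = (3 * mode 0 k (pow_g i) + mode 0 k (pow_g (Suc i)) + mode 0 k (pow_g (i + n - 1))) / 5"
    by (simp add: mode_Suc schrodinger_def fwd_pow_g bwd_pow_g)
  also have "\<dots> = ((\<Sum>j<n. 3 * (eigenvalue j ^ k * cosmod n (int i * int j))
      + eigenvalue j ^ k * cosmod n (int (Suc i) * int j)
      + eigenvalue j ^ k * cosmod n (int (i + n - 1) * int j)) / real n) / 5"
    unfolding Suc.IH by (simp add: sum.distrib sum_distrib_left add_divide_distrib)
  also have "\<dots> = (\<Sum>j<n. eigenvalue j ^ Suc k * cosmod n (int i * int j)) / real n"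
    unfolding step by (simp flip: sum_distrib_left)
  finally show ?case .
qed

lemma eigenvalue_reflect: "j \<le> n \<Longrightarrow> eigenvalue (n - j) = eigenvalue j"
proof -
  assume "j \<le> n"
  then have "cosmod n (int (n - j)) = cosmod n (- int j)"
    using n_pos by (intro cosmod_cong) (simp_all add: cong_iff_dvd_diff of_nat_diff)
  then show ?thesis by (simp add: eigenvalue_def)
qed

text \<open>
  The inverse transform. It is needed for \<open>l = 0\<close>, the total mass of the walk, and for \<open>l = 1\<close>, the
  slowest mode, which gives the lower bound.
\<close>
lemma mode_0_coefficient:
  assumes l: "l < n"
  shows "(\<Sum>i<n. mode 0 k (pow_g i) * cosmod n (int i * int l)) = eigenvalue l ^ k"
proof -
  have eq_if_cong: "int n dvd int j - int l \<longleftrightarrow> j = l" if "j < n" "l < n" for j l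
    using cong_less_modulus_unique_nat[of j l n] that by (auto simp flip: cong_iff_dvd_diff cong_int_iff)
  have minus: "int n dvd int j - int l \<longleftrightarrow> j = l" if "j < n" for j
    using eq_if_cong that l by blast
  \<comment> \<open>The sum over \<open>i\<close> does not distinguish the frequencies \<open>l\<close> and \<open>- l\<close>, the latter represented by \<open>l'\<close>.\<close>
  define l' where "l' = (if l = 0 then 0 else n - l)"
  have l': "l' < n" "int n dvd int l' + int l" using l by (auto simp: l'_def of_nat_diff)
  have plus: "int n dvd int j + int l \<longleftrightarrow> j = l'" if "j < n" for j
  proof
    assume "int n dvd int j + int l"
    then have "int n dvd (int j + int l) - (int l' + int l)" using l'(2) by (rule dvd_diff)
    then have "int n dvd int j - int l'" by simp
    then show "j = l'" using eq_if_cong that l'(1) by blast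
  qed (use l' in simp)
  have "eigenvalue l' = eigenvalue l" using l by (simp add: l'_def eigenvalue_reflect)
  have "(\<Sum>i<n. mode 0 k (pow_g i) * cosmod n (int i * int l))
    = (\<Sum>i<n. \<Sum>j<n. eigenvalue j ^ k / real n * (cosmod n (int i * int j) * cosmod n (int i * int l)))"
    by (simp add: mode_0_pow_g sum_divide_distrib sum_distrib_right mult.assoc)
  also have "\<dots> = (\<Sum>j<n. eigenvalue j ^ k / real n
      * (\<Sum>i<n. cosmod n (int i * int j) * cosmod n (int i * int l)))"
    unfolding sum_distrib_left by (rule sum.swap)
  also have "\<dots> = (\<Sum>j<n. (if j = l' then eigenvalue j ^ k / 2 else 0)
      + (if j = l then eigenvalue j ^ k / 2 else 0))"
    unfolding sum_cosmod_mult[OF n_pos] using n_pos by (intro sum.cong refl) (simp add: minus plus)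
  also have "\<dots> = eigenvalue l ^ k"
    using l l'(1) by (simp add: sum.distrib \<open>eigenvalue l' = eigenvalue l\<close>)
  finally show ?thesis .
qed

section \<open>Total variation distance and the linear part\<close>

lemma sum_walk_fibre:
  assumes a: "a \<in> units"
  shows "(\<Sum>b\<in>{0..int p - 1}. walk k (a, b)) = mode 0 k a"
proof -
  have reindex: "(\<Sum>b\<in>{0..int p - 1}. f b) = (\<Sum>x<p. f (int x))" for f :: "int \<Rightarrow> real"
    by (intro sum.reindex_bij_witness[of _ int nat]) auto
  have "(\<Sum>b\<in>{0..int p - 1}. walk k (a, b))
      = (\<Sum>b\<in>{0..int p - 1}. (\<Sum>\<xi><p. mode (int \<xi>) k a * cosmod p (int \<xi> * b)) / real p)"
    using a by (intro sum.cong) (auto simp: walk_eq_sum_modes)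
  also have "\<dots> = (\<Sum>\<xi><p. \<Sum>b\<in>{0..int p - 1}. mode (int \<xi>) k a * cosmod p (int \<xi> * b)) / real p"
    unfolding sum_divide_distrib[symmetric] by (subst sum.swap) (rule refl)
  also have "\<dots> = (\<Sum>\<xi><p. mode (int \<xi>) k a * (if int p dvd int \<xi> then real p else 0)) / real p"
    using p_gt_1 by (simp add: reindex sum_cosmod flip: sum_distrib_left)
  also have "\<dots> = (\<Sum>\<xi><p. if \<xi> = 0 then mode (int \<xi>) k a * real p else 0) / real p"
    by (intro arg_cong2[of _ _ _ _ "(/)"] sum.cong) (auto dest: dvd_imp_le)
  finally show ?thesis using p_gt_1 by simp
qed

lemma sum_walk: "(\<Sum>h\<in>carrier G. walk k h) = 1"
proof -
  have "(\<Sum>h\<in>carrier G. walk k h) = (\<Sum>a\<in>units. \<Sum>b\<in>{0..int p - 1}. walk k (a, b))"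
    by (simp add: carrier_G sum.cartesian_product)
  also have "\<dots> = (\<Sum>a\<in>units. mode 0 k a)" by (intro sum.cong sum_walk_fibre refl)
  also have "\<dots> = (\<Sum>i<n. mode 0 k (pow_g i))"
    by (rule sum.reindex_bij_betw[OF bij_pow_g, symmetric])
  also have "\<dots> = 1" using mode_0_coefficient[of 0 k] n_pos by (simp add: eigenvalue_def)
  finally show ?thesis .
qed

lemma walk_nonneg: "h \<in> carrier G \<Longrightarrow> walk k h \<ge> 0"
proof (induction k arbitrary: h)
  case (Suc k)
  obtain a b where h: "h = (a, b)" "a \<in> units" "b \<in> {0..int p - 1}"
    using Suc.prems unfolding carrier_G by (cases h) blast
  have m: "x mod int p \<in> {0..int p - 1}" for x using p_gt_1 pos_mod_bound[of "int p" x] by simp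
  show ?case unfolding h(1) walk_Suc[OF h(2,3)]
    using h(2,3) m fwd_mem[OF h(2)] bwd_mem[OF h(2)]
    by (intro divide_nonneg_pos add_nonneg_nonneg Suc.IH) (auto simp: carrier_G)
qed simp

abbreviation tv :: "nat \<Rightarrow> real" where
  "tv k \<equiv> tv_dist G (walk k) (uniform_affine p)"

lemma tv_le_1: "tv k \<le> 1"
proof -
  let ?U = "1 / (real p * (real p - 1))"
  have U: "?U \<ge> 0" using p_gt_1 by simp
  have "(\<Sum>h\<in>carrier G. \<bar>walk k h - ?U\<bar>) \<le> (\<Sum>h\<in>carrier G. walk k h + ?U)"
    using walk_nonneg U by (intro sum_mono) (auto simp: abs_le_iff)
  also have "\<dots> = 1 + real (card (carrier G)) * ?U" by (simp add: sum.distrib sum_walk)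
  also have "real (card (carrier G)) = real p * (real p - 1)"
    using p_gt_1 by (simp add: carrier_G of_nat_n)
  also have "1 + \<dots> * ?U = 2" using p_gt_1 by simp
  finally show ?thesis by (simp add: tv_dist_def uniform_affine_def)
qed

text \<open>
  Total variation distance decreases under the projection \<open>(a, b) \<mapsto> a\<close>.
\<close>
lemma sum_abs_mode_0_le_tv: "(\<Sum>i<n. \<bar>mode 0 k (pow_g i) - 1 / real n\<bar>) \<le> 2 * tv k"
proof -
  let ?U = "1 / (real p * (real p - 1))"
  have "(\<Sum>i<n. \<bar>mode 0 k (pow_g i) - 1 / real n\<bar>) = (\<Sum>a\<in>units. \<bar>mode 0 k a - 1 / real n\<bar>)"
    by (rule sum.reindex_bij_betw[OF bij_pow_g])
  also have "\<dots> = (\<Sum>a\<in>units. \<bar>\<Sum>b\<in>{0..int p - 1}. walk k (a, b) - ?U\<bar>)"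
    using p_gt_1 by (intro sum.cong refl) (simp add: sum_subtractf sum_walk_fibre of_nat_n)
  also have "\<dots> \<le> (\<Sum>a\<in>units. \<Sum>b\<in>{0..int p - 1}. \<bar>walk k (a, b) - ?U\<bar>)"
    by (intro sum_mono sum_abs)
  also have "\<dots> = 2 * tv k"
    by (simp add: tv_dist_def carrier_G uniform_affine_def sum.cartesian_product)
  finally show ?thesis .
qed

text \<open>
  Conversely, the projection to \<open>a\<close> accounts for everything except the nonzero frequencies. For these
  the pointwise bound is simply summed over the fewer than \<open>p\<^sup>2\<close> group elements.
\<close>
lemma tv_le_sum_abs_mode_0:
  "2 * tv k \<le> (\<Sum>i<n. \<bar>mode 0 k (pow_g i) - 1 / real n\<bar>)
    + (real p)\<^sup>2 * exp (- (real k / (360 * real p)))"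
proof -
  let ?U = "1 / (real p * (real p - 1))" and ?e = "exp (- (real k / (360 * real p)))"
  have pt: "\<bar>walk k (a, b) - ?U\<bar> \<le> \<bar>mode 0 k a - 1 / real n\<bar> / real p + ?e"
    if a: "a \<in> units" and b: "b \<in> {0..int p - 1}" for a b
  proof -
    \<comment> \<open>The frequency 0 contributes the deviation of the linear part from uniformity; all other
      frequencies are bounded by their decay rate.\<close>
    let ?R = "\<Sum>\<xi>\<in>{1..<p}. mode (int \<xi>) k a * cosmod p (int \<xi> * b)"
    have "{..<p} = insert 0 {1..<p}" using p_gt_1 by auto
    then have "walk k (a, b) - ?U = ((mode 0 k a - 1 / real n) + ?R) / real p"
      using p_gt_1 by (simp add: walk_eq_sum_modes[OF a b] of_nat_n field_simps)
    then have "\<bar>walk k (a, b) - ?U\<bar> = \<bar>(mode 0 k a - 1 / real n) + ?R\<bar> / real p" by simp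
    also have "\<dots> \<le> (\<bar>mode 0 k a - 1 / real n\<bar> + \<bar>?R\<bar>) / real p"
      by (intro divide_right_mono abs_triangle_ineq) simp
    also have "\<dots> = \<bar>mode 0 k a - 1 / real n\<bar> / real p + \<bar>?R\<bar> / real p"
      by (rule add_divide_distrib)
    also have "\<bar>?R\<bar> \<le> (\<Sum>\<xi>\<in>{1..<p}. ?e)"
    proof (intro order_trans[OF sum_abs] sum_mono)
      fix \<xi> assume "\<xi> \<in> {1..<p}"
      then have "\<not> int p dvd int \<xi>" by (auto dest: dvd_imp_le)
      then have "\<bar>mode (int \<xi>) k a\<bar> * \<bar>cosmod p (int \<xi> * b)\<bar> \<le> ?e * 1"
        using a abs_cosmod_le_1 by (intro mult_mono abs_mode_le) auto
      then show "\<bar>mode (int \<xi>) k a * cosmod p (int \<xi> * b)\<bar> \<le> ?e" by (simp add: abs_mult)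
    qed
    also have "(\<Sum>\<xi>\<in>{1..<p}. ?e) = real (p - 1) * ?e" by simp
    also have "\<dots> \<le> real p * ?e" by (intro mult_right_mono) auto
    also have "real p * ?e / real p = ?e" using p_gt_1 by simp
    finally show ?thesis by (simp add: divide_right_mono)
  qed
  have "2 * tv k = (\<Sum>a\<in>units. \<Sum>b\<in>{0..int p - 1}. \<bar>walk k (a, b) - ?U\<bar>)"
    by (simp add: tv_dist_def carrier_G uniform_affine_def sum.cartesian_product)
  also have "\<dots> \<le> (\<Sum>a\<in>units. \<Sum>b\<in>{0..int p - 1}. \<bar>mode 0 k a - 1 / real n\<bar> / real p + ?e)"
    by (intro sum_mono pt)
  also have "\<dots> = (\<Sum>a\<in>units. \<bar>mode 0 k a - 1 / real n\<bar>) + real n * real p * ?e"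
    using p_gt_1 by (simp add: sum.distrib of_nat_n distrib_left)
  also have "(\<Sum>a\<in>units. \<bar>mode 0 k a - 1 / real n\<bar>) = (\<Sum>i<n. \<bar>mode 0 k (pow_g i) - 1 / real n\<bar>)"
    by (rule sum.reindex_bij_betw[OF bij_pow_g, symmetric])
  also have "real n * real p * ?e \<le> (real p)\<^sup>2 * ?e"
    using p_gt_1 by (intro mult_right_mono) (auto simp: power2_eq_square n_def)
  finally show ?thesis by simp
qed

section \<open>Exponential rates\<close>

lemma eigenvalue_eq_sin: "eigenvalue j = 1 - 4 / 5 * (sin (pi * real j / real n))\<^sup>2"
proof -
  have "2 * pi * of_int (int j) / of_nat n = 2 * (pi * real j / real n)" by simp
  then have "cosmod n (int j) = 1 - 2 * (sin (pi * real j / real n))\<^sup>2"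
    unfolding cosmod_def by (simp only: cos_double_sin)
  then show ?thesis by (simp add: eigenvalue_def)
qed

lemma eigenvalue_ge: "eigenvalue j \<ge> 1 / 5"
  using abs_cosmod_le_1[of n "int j"] by (simp add: eigenvalue_def abs_le_iff)

text \<open>
  The power of the eigenvalue is at most \<open>exp (- s m\<^sup>2 / 3)\<close> with \<open>s = k / p\<^sup>2 \<ge> 1\<close>. Since \<open>s, m \<ge> 1\<close>, the
  product \<open>s m\<^sup>2\<close> is at least \<open>(s + m) / 2\<close>, which separates the decay in time from a factor that is summable
  in \<open>m\<close>.
\<close>
lemma eigenvalue_power_le:
  assumes m: "0 < m" "2 * m \<le> n" and k: "k \<ge> p\<^sup>2"
  shows "eigenvalue m ^ k \<le> exp (- (real k / (6 * (real p)\<^sup>2))) * exp (- (1 / 6)) ^ m"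
proof -
  define s where "s = real k / (real p)\<^sup>2"
  define x where "x = pi * real m / real n"
  have s1: "s \<ge> 1"
  proof -
    have "real k \<ge> real (p\<^sup>2)" using k by (simp only: of_nat_le_iff)
    then show ?thesis using p_gt_1 by (simp add: s_def)
  qed
  have "real (2 * m) \<le> real n" using m(2) by (simp only: of_nat_le_iff)
  then have "x \<le> pi / 2" using n_pos by (simp add: x_def field_simps)
  then have "x / 3 \<le> sin x" using n_pos by (intro third_le_sin) (auto simp: x_def)
  moreover have "2 * real m / real n / 3 \<le> x / 3"
    using pi_ge_two unfolding x_def by (intro divide_right_mono mult_right_mono) auto
  ultimately have "2 * real m / real n / 3 \<le> sin x" by linarith
  then have "(2 * real m / real n / 3)\<^sup>2 \<le> (sin x)\<^sup>2" by (intro power_mono) auto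
  moreover have "(2 * real m / real n / 3)\<^sup>2 = 4 / 9 * ((real m)\<^sup>2 / (real n)\<^sup>2)"
    by (simp add: power_divide power_mult_distrib)
  moreover have "(real m)\<^sup>2 / (real p)\<^sup>2 \<le> (real m)\<^sup>2 / (real n)\<^sup>2"
    using n_pos by (intro divide_left_mono power_mono) (auto simp: n_def)
  ultimately have "(sin x)\<^sup>2 \<ge> 4 / 9 * ((real m)\<^sup>2 / (real p)\<^sup>2)" by linarith
  moreover have "eigenvalue m = 1 - 4 / 5 * (sin x)\<^sup>2" by (simp only: eigenvalue_eq_sin x_def)
  moreover have "(real m)\<^sup>2 / (real p)\<^sup>2 \<ge> 0" by simp
  ultimately have "eigenvalue m \<le> 1 - 1 / 3 * ((real m)\<^sup>2 / (real p)\<^sup>2)" by linarith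
  also have "\<dots> \<le> exp (- (1 / 3 * ((real m)\<^sup>2 / (real p)\<^sup>2)))"
    using exp_ge_add_one_self[of "- (1 / 3 * ((real m)\<^sup>2 / (real p)\<^sup>2))"] by simp
  finally have "eigenvalue m ^ k \<le> exp (- (1 / 3 * ((real m)\<^sup>2 / (real p)\<^sup>2))) ^ k"
    using eigenvalue_ge[of m] by (intro power_mono) auto
  also have "\<dots> = exp (- (s * (real m)\<^sup>2 / 3))"
    by (simp add: s_def flip: exp_of_nat_mult)
  also have "\<dots> \<le> exp (- (s / 6) - real m / 6)"
  proof -
    have "real m \<le> (real m)\<^sup>2" using m(1) by (simp add: power2_eq_square)
    then have "s * real m \<le> s * (real m)\<^sup>2" using s1 by (intro mult_left_mono) auto
    moreover have "(s - 1) * (real m - 1) \<ge> 0" using s1 m(1) by simp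
    moreover have "s * real m \<ge> 1 * 1" using s1 m(1) by (intro mult_mono) auto
    ultimately show ?thesis by (simp add: algebra_simps)
  qed
  also have "\<dots> = exp (- (s / 6)) * exp (- (1 / 6)) ^ m"
    by (simp flip: exp_of_nat_mult exp_add)
  finally show ?thesis by (simp add: s_def mult.commute)
qed

text \<open>
  The frequencies \<open>j\<close> and \<open>n - j\<close> have the same eigenvalue, so the nontrivial part of the spectrum is
  dominated by two geometric series, with a constant that depends neither on \<open>p\<close> nor on \<open>k\<close>.
\<close>
lemma sum_abs_mode_0_le:
  assumes k: "k \<ge> p\<^sup>2"
  shows "(\<Sum>i<n. \<bar>mode 0 k (pow_g i) - 1 / real n\<bar>)
    \<le> 2 / (1 - exp (- (1 / 6))) * exp (- (real k / (6 * (real p)\<^sup>2)))"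
proof -
  define r :: real where "r = exp (- (1 / 6))"
  define E where "E = exp (- (real k / (6 * (real p)\<^sup>2)))"
  have r: "0 < r" "r < 1" by (auto simp: r_def)
  have pt: "\<bar>mode 0 k (pow_g i) - 1 / real n\<bar> \<le> (\<Sum>j\<in>{1..<n}. eigenvalue j ^ k) / real n" for i
  proof -
    have "{..<n} = insert 0 {1..<n}" using n_pos by auto
    then have "mode 0 k (pow_g i) - 1 / real n
        = (\<Sum>j\<in>{1..<n}. eigenvalue j ^ k * cosmod n (int i * int j)) / real n"
      by (simp add: mode_0_pow_g eigenvalue_def[of 0] add_divide_distrib)
    moreover have "\<bar>\<Sum>j\<in>{1..<n}. eigenvalue j ^ k * cosmod n (int i * int j)\<bar>
        \<le> (\<Sum>j\<in>{1..<n}. eigenvalue j ^ k)"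
    proof (intro order_trans[OF sum_abs] sum_mono)
      fix j
      have "\<bar>eigenvalue j ^ k\<bar> * \<bar>cosmod n (int i * int j)\<bar> \<le> \<bar>eigenvalue j ^ k\<bar> * 1"
        by (intro mult_left_mono abs_cosmod_le_1) auto
      then show "\<bar>eigenvalue j ^ k * cosmod n (int i * int j)\<bar> \<le> eigenvalue j ^ k"
        using eigenvalue_ge[of j] by (simp add: abs_mult)
    qed
    ultimately show ?thesis by (simp add: divide_right_mono)
  qed
  have ev: "eigenvalue j ^ k \<le> E * (r ^ j + r ^ (n - j))" if j: "j \<in> {1..<n}" for j
  proof (cases "2 * j \<le> n")
    case True
    then have "eigenvalue j ^ k \<le> E * r ^ j"
      using eigenvalue_power_le[of j k] j k by (simp add: E_def r_def)
    also have "\<dots> \<le> E * (r ^ j + r ^ (n - j))" using r by (simp add: E_def)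
    finally show ?thesis .
  next
    case False
    then have "eigenvalue (n - j) ^ k \<le> E * r ^ (n - j)"
      using eigenvalue_power_le[of "n - j" k] j k by (simp add: E_def r_def)
    also have "\<dots> \<le> E * (r ^ j + r ^ (n - j))" using r by (simp add: E_def)
    finally show ?thesis using j by (simp add: eigenvalue_reflect)
  qed
  have geo: "(\<Sum>j\<in>{1..<n}. r ^ j) \<le> 1 / (1 - r)"
  proof -
    have "(\<Sum>j\<in>{1..<n}. r ^ j) \<le> (\<Sum>j<n. r ^ j)" using r by (intro sum_mono2) auto
    also have "\<dots> = (1 - r ^ n) / (1 - r)" using r by (simp add: sum_gp_strict)
    also have "\<dots> \<le> 1 / (1 - r)" using r by (intro divide_right_mono) auto
    finally show ?thesis .
  qed
  have "(\<Sum>i<n. \<bar>mode 0 k (pow_g i) - 1 / real n\<bar>)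
      \<le> (\<Sum>i<n. (\<Sum>j\<in>{1..<n}. eigenvalue j ^ k) / real n)"
    by (intro sum_mono pt)
  also have "\<dots> = (\<Sum>j\<in>{1..<n}. eigenvalue j ^ k)" using n_pos by simp
  also have "\<dots> \<le> (\<Sum>j\<in>{1..<n}. E * (r ^ j + r ^ (n - j)))" by (intro sum_mono ev)
  also have "\<dots> = E * ((\<Sum>j\<in>{1..<n}. r ^ j) + (\<Sum>j\<in>{1..<n}. r ^ (n - j)))"
    by (simp add: sum_distrib_left sum.distrib distrib_left)
  also have "(\<Sum>j\<in>{1..<n}. r ^ (n - j)) = (\<Sum>j\<in>{1..<n}. r ^ j)"
    by (intro sum.reindex_bij_witness[of _ "\<lambda>j. n - j" "\<lambda>j. n - j"]) auto
  also have "E * ((\<Sum>j\<in>{1..<n}. r ^ j) + (\<Sum>j\<in>{1..<n}. r ^ j)) \<le> E * (1 / (1 - r) + 1 / (1 - r))"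
    using geo by (intro mult_left_mono add_mono) (auto simp: E_def)
  finally show ?thesis by (simp add: E_def r_def mult.commute)
qed

lemma tv_upper_bound:
  "tv k \<le> (2 / (1 - exp (- (1 / 6))) + 1036800 + exp 1) * exp (- (real k / (360 * (real p)\<^sup>2)))"
proof -
  define s where "s = real k / (real p)\<^sup>2"
  define C :: real where "C = 2 / (1 - exp (- (1 / 6)))"
  have C: "C \<ge> 0" by (simp add: C_def)
  have s0: "s \<ge> 0" by (simp add: s_def)
  have ks: "real k = s * (real p)\<^sup>2" using p_gt_1 by (simp add: s_def)
  have "tv k \<le> (C + 1036800 + exp 1) * exp (- (s / 360))"
  proof (cases "k \<ge> p\<^sup>2")
    case False
    then have "real k < real (p\<^sup>2)" by (simp only: of_nat_less_iff not_le)
    then have "s < 1" using p_gt_1 by (simp add: s_def)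
    \<comment> \<open>Before time \<open>p\<^sup>2\<close> the trivial bound suffices.\<close>
    have "tv k \<le> exp (1 - s / 360)" using tv_le_1 \<open>s < 1\<close> s0
      by (intro order_trans[OF tv_le_1]) simp
    also have "\<dots> = exp 1 * exp (- (s / 360))" by (simp flip: exp_add)
    also have "\<dots> \<le> (C + 1036800 + exp 1) * exp (- (s / 360))" using C by (intro mult_right_mono) auto
    finally show ?thesis .
  next
    case True
    then have "real k \<ge> real (p\<^sup>2)" by (simp only: of_nat_le_iff)
    then have s1: "s \<ge> 1" using p_gt_1 by (simp add: s_def)
    have cycle: "(\<Sum>i<n. \<bar>mode 0 k (pow_g i) - 1 / real n\<bar>) \<le> C * exp (- (s / 360))"
    proof -
      have "(\<Sum>i<n. \<bar>mode 0 k (pow_g i) - 1 / real n\<bar>) \<le> C * exp (- (s / 6))"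
        using sum_abs_mode_0_le[OF True] by (simp add: C_def s_def mult.commute)
      also have "\<dots> \<le> C * exp (- (s / 360))" using C s0 by (intro mult_left_mono) auto
      finally show ?thesis .
    qed
    have rest: "(real p)\<^sup>2 * exp (- (real k / (360 * real p))) \<le> 1036800 * exp (- (s / 360))"
    proof -
      \<comment> \<open>With \<open>k = s p\<^sup>2\<close> the exponent is \<open>s p / 360 = 2 s y\<close>. One half of it gives the wanted decay in \<open>s\<close>,
        the other half absorbs \<open>p\<^sup>2\<close> because \<open>p\<^sup>2 exp (- y) = 720\<^sup>2 y\<^sup>2 exp (- y) \<le> 2 \<cdot> 720\<^sup>2\<close>.\<close>
      define y where "y = real p / 720"
      have y0: "y \<ge> 0" by (simp add: y_def)
      have "real k / (360 * real p) = s * y + s * y"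
        using p_gt_1 by (simp add: ks y_def power2_eq_square)
      moreover have "s * y \<ge> s * (2 / 720)" using s0 p_gt_1 by (intro mult_left_mono) (auto simp: y_def)
      moreover have "s * y \<ge> 1 * y" using s1 y0 by (intro mult_right_mono) auto
      ultimately have "exp (- (real k / (360 * real p))) \<le> exp (- y + - (s / 360))" by simp
      then have "exp (- (real k / (360 * real p))) \<le> exp (- y) * exp (- (s / 360))"
        by (simp only: exp_add)
      then have "(real p)\<^sup>2 * exp (- (real k / (360 * real p)))
          \<le> (real p)\<^sup>2 * (exp (- y) * exp (- (s / 360)))" by (intro mult_left_mono) auto
      also have "\<dots> = (518400 * (y\<^sup>2 * exp (- y))) * exp (- (s / 360))"
        by (simp add: y_def power_divide)
      also have "\<dots> \<le> 1036800 * exp (- (s / 360))"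
      proof (intro mult_right_mono)
        have "y\<^sup>2 \<le> 2 * exp y" using exp_lower_Taylor_quadratic[OF y0] y0 by simp
        then have "y\<^sup>2 * exp (- y) \<le> 2" by (simp add: exp_minus field_simps)
        then show "518400 * (y\<^sup>2 * exp (- y)) \<le> 1036800" by linarith
      qed auto
      finally show ?thesis .
    qed
    have "2 * tv k \<le> (C + 1036800) * exp (- (s / 360))"
      using tv_le_sum_abs_mode_0[of k] cycle rest by (simp add: distrib_right)
    moreover have "tv k \<ge> 0" by (simp add: tv_dist_def sum_nonneg)
    ultimately have "tv k \<le> (C + 1036800) * exp (- (s / 360))" by linarith
    also have "\<dots> \<le> (C + 1036800 + exp 1) * exp (- (s / 360))" by (intro mult_right_mono) auto
    finally show ?thesis .
  qed
  then show ?thesis by (simp add: C_def s_def mult.commute)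
qed

text \<open>
  Testing the distribution of the linear part against the slowest nontrivial mode, a function of absolute value
  at most 1 and mean 0.
\<close>
lemma tv_lower_bound_odd:
  assumes "p > 2"
  shows "exp (- 256 * (real k / (real p)\<^sup>2)) / 2 \<le> tv k"
proof -
  have n2: "1 < n" using assms by (simp add: n_def)
  have "(\<Sum>i<n. (mode 0 k (pow_g i) - 1 / real n) * cosmod n (int i * int 1))
      = eigenvalue 1 ^ k - (\<Sum>i<n. cosmod n (1 * int i)) / real n"
    using mode_0_coefficient[OF n2, of k]
    by (simp add: left_diff_distrib sum_subtractf sum_divide_distrib)
  also have "(\<Sum>i<n. cosmod n (1 * int i)) = 0"
    using n2 by (subst sum_cosmod) (auto simp: zdvd1_eq)
  finally have "eigenvalue 1 ^ k
      = (\<Sum>i<n. (mode 0 k (pow_g i) - 1 / real n) * cosmod n (int i * int 1))" by simp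
  also have "\<dots> \<le> (\<Sum>i<n. \<bar>mode 0 k (pow_g i) - 1 / real n\<bar>)"
  proof (intro sum_mono)
    fix i
    let ?w = "mode 0 k (pow_g i) - 1 / real n" and ?c = "cosmod n (int i * int 1)"
    have "?w * ?c \<le> \<bar>?w\<bar> * \<bar>?c\<bar>" using abs_ge_self[of "?w * ?c"] by (simp only: abs_mult)
    also have "\<dots> \<le> \<bar>?w\<bar> * 1" by (intro mult_left_mono abs_cosmod_le_1) auto
    finally show "?w * ?c \<le> \<bar>?w\<bar>" by simp
  qed
  also have "\<dots> \<le> 2 * tv k" by (rule sum_abs_mode_0_le_tv)
  finally have main: "eigenvalue 1 ^ k \<le> 2 * tv k" .
  define x where "x = 4 / 5 * (sin (pi / real n))\<^sup>2"
  have ev: "eigenvalue 1 = 1 - x" by (simp add: eigenvalue_eq_sin x_def)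
  have "5 * x \<le> 256 / (real p)\<^sup>2"
  proof -
    \<comment> \<open>The bound comes from \<open>\<pi> < 4\<close> and \<open>n = p - 1 \<ge> p / 2\<close>.\<close>
    have "\<bar>sin (pi / real n)\<bar> \<le> \<bar>8 / real p\<bar>"
    proof -
      have "\<bar>sin (pi / real n)\<bar> \<le> pi / real n" using abs_sin_x_le_abs_x[of "pi / real n"] by simp
      also have "\<dots> \<le> 4 / (real p / 2)"
        using pi_less_4 assms by (intro frac_le) (auto simp: of_nat_n)
      finally show ?thesis by simp
    qed
    then have "(sin (pi / real n))\<^sup>2 \<le> (8 / real p)\<^sup>2" by (simp only: abs_le_square_iff)
    then show ?thesis by (simp add: x_def power_divide)
  qed
  then have "exp (- 256 / (real p)\<^sup>2) \<le> exp (- (5 * x))" by simp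
  also have "\<dots> \<le> eigenvalue 1"
    using eigenvalue_ge[of 1] unfolding ev by (intro exp_minus_5_mult_le) (auto simp: x_def)
  finally have "exp (- 256 / (real p)\<^sup>2) \<le> eigenvalue 1" .
  then have "exp (- 256 / (real p)\<^sup>2) ^ k \<le> eigenvalue 1 ^ k" by (intro power_mono) auto
  also have "exp (- 256 / (real p)\<^sup>2) ^ k = exp (- 256 * (real k / (real p)\<^sup>2))"
    by (simp flip: exp_of_nat_mult)
  finally show ?thesis using main by simp
qed

text \<open>
  For \<open>p = 2\<close> the multiplicative group is trivial and has no nonconstant mode; the nontrivial
  additive frequency takes over. Its mode decays like \<open>(1 / 5)^k\<close> because the two translations together
  contribute -2 and the other three steps 3.
\<close>
lemma tv_lower_bound_2:
  assumes p2: "p = 2"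
  shows "(1 / 5) ^ k / 4 \<le> tv k"
proof -
  have U: "units = {1}" by (auto simp: p2)
  then have fix1: "fwd 1 = 1" "bwd 1 = 1" using fwd_mem[of 1] bwd_mem[of 1] by auto
  have c1: "cosmod p 1 = - 1" by (simp add: cosmod_def p2)
  have m0: "mode 0 k 1 = 1"
    by (induction k) (simp_all add: mode_0 mode_Suc schrodinger_def fix1)
  have m1: "mode 1 k 1 = (1 / 5) ^ k"
    by (induction k) (simp_all add: mode_0 mode_Suc schrodinger_def fix1 c1)
  have "walk k (1, 0) = (\<Sum>\<xi><2. mode (int \<xi>) k 1) / 2"
    using walk_eq_sum_modes[of 1 0 k] p2 by simp
  then have w: "walk k (1, 0) - 1 / 2 = (1 / 5) ^ k / 2"
    using m0 m1 by (simp add: numeral_2_eq_2)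
  have "\<bar>walk k (1, 0) - uniform_affine p (1, 0)\<bar>
      \<le> (\<Sum>h\<in>carrier G. \<bar>walk k h - uniform_affine p h\<bar>)"
    using p_gt_1 by (intro member_le_sum[of "(1, 0)"]) (auto simp: carrier_G)
  then show ?thesis using w by (simp add: tv_dist_def uniform_affine_def p2)
qed

lemma tv_lower_bound: "1 / 4 * exp (- 256 * (real k / (real p)\<^sup>2)) \<le> tv k"
proof (cases "p = 2")
  case False
  then have "exp (- 256 * (real k / (real p)\<^sup>2)) / 2 \<le> tv k" using tv_lower_bound_odd p_gt_1 by simp
  then show ?thesis using exp_gt_zero[of "- 256 * (real k / (real p)\<^sup>2)"] by linarith
next
  case True
  have "exp (- 64 :: real) \<le> 1 / 5"
    using exp_ge_add_one_self[of "64 :: real"] by (simp add: exp_minus field_simps)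
  then have "exp (- 64 :: real) ^ k \<le> (1 / 5) ^ k" by (intro power_mono) auto
  then have "exp (- 64 * real k) \<le> (1 / 5) ^ k" by (simp add: mult.commute flip: exp_of_nat_mult)
  then show ?thesis using tv_lower_bound_2[OF True, of k] True by simp
qed

end

theorem theorem5:
  "\<exists>c1 c2 c2' c3 :: real. c1 > 0 \<and> c2 > 0 \<and> c2' > 0 \<and> c3 > 0 \<and>
     (\<forall>p g k :: nat. prime p \<longrightarrow> residue_primroot p g \<longrightarrow> g < p \<longrightarrow> k \<ge> 1 \<longrightarrow>
        c1 * exp (- c2 * (real k / (real p)\<^sup>2))
          \<le> tv_dist (affine_group p) (conv_power (affine_group p) (walk_measure p g) k) (uniform_affine p)
      \<and> tv_dist (affine_group p) (conv_power (affine_group p) (walk_measure p g) k) (uniform_affine p)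
          \<le> c3 * exp (- (c2' * real k / (real p)\<^sup>2)))"
proof -
  define c3 :: real where "c3 = 2 / (1 - exp (- (1 / 6))) + 1036800 + exp 1"
  have "c3 > 0" unfolding c3_def by (intro add_pos_pos) auto
  moreover have "1 / 4 * exp (- 256 * (real k / (real p)\<^sup>2))
        \<le> tv_dist (affine_group p) (conv_power (affine_group p) (walk_measure p g) k) (uniform_affine p)
      \<and> tv_dist (affine_group p) (conv_power (affine_group p) (walk_measure p g) k) (uniform_affine p)
        \<le> c3 * exp (- (1 / 360 * real k / (real p)\<^sup>2))"
    if "prime p" "residue_primroot p g" "g < p" for p g k :: nat
  proof -
    interpret affine_walk p g using that by unfold_locales
    show ?thesis using tv_lower_bound[of k] tv_upper_bound[of k] by (simp add: c3_def)
  qed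
  ultimately show ?thesis
    by (intro exI[of _ "1 / 4 :: real"] exI[of _ "256 :: real"] exI[of _ "1 / 360 :: real"] exI[of _ c3]) simp
qed

end
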